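(* Let $(A,\cdot,[-,-],P)$ be a relative Poisson algebra which is dually represented by a linear map $Q:A\to A$. Let $r\in A\otimes A$ and let $\Delta,\delta:A\to A\otimes A$ be the linear maps defined by $$\Delta(x)=(\mathrm{id}\otimes\mathcal L(x)-\mathcal L(x)\otimes\mathrm{id})r,\qquad \delta(x)=(\mathrm{ad}(x)\otimes\mathrm{id}+\mathrm{id}\otimes\mathrm{ad}(x))r,\qquad x\in A.$$ If $r$ is antisymmetric in the sense that $r+\tau(r)=0$, and $r$ satisfies the associative Yang-Baxter equation $r_{12}\cdot r_{13}-r_{12}\cdot r_{23}+r_{13}\cdot r_{23}=0$ in $(A,\cdot)$, the classical Yang-Baxter equation $[r_{12},r_{13}]+[r_{12},r_{23}]+[r_{13},r_{23}]=0$ in $(A,[-,-])$, and the equations $$(P\otimes\mathrm{id}-\mathrm{id}\otimes Q)r=0,\qquad (Q\otimes\mathrm{id}-\mathrm{id}\otimes P)r=0,$$ then $(A,\cdot,[-,-],\Delta,\delta,P,Q)$ is a coboundary relative Poisson bialgebra.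
   Context: All vector spaces are finite-dimensional over an algebraically closed field $\mathbb K$ of characteristic zero. Relative Poisson algebra. $(A,\cdot,[-,-],P)$, abbreviated $(A,P)$: $(A,\cdot)$ is a commutative associative (not necessarily unital) algebra, $(A,[-,-])$ is a Lie algebra, $P:A\to A$ is a linear map that is a derivation of both $\cdot$ and $[-,-]$, and $[z,x\cdot y]=[z,x]\cdot y+x\cdot[z,y]+x\cdot y\cdot P(z)$ for all $x,y,z\in A$. Write $\mathcal L(x)y=x\cdot y$, $\mathrm{ad}(x)y=[x,y]$, $\tau(x\otimes y)=y\otimes x$. A linear map $Q:A\to A$ dually represents $(A,P)$ if for all $x,y,z\in A$: $x\cdot Q(y)-P(x)\cdot y-Q(x\cdot y)=0$; $[x,Q(y)]-[P(x),y]-Q([x,y])=0$; $[x,y\cdot z]+[y,z\cdot x]+[z,x\cdot y]+Q(x\cdot y\cdot z)=0$. For $r=\sum_ia_i\otimes b_i$ and a bilinear operation $\diamond$ on $A$: $r_{12}\diamond r_{13}=\sum_{i,j}a_i\diamond a_j\otimes b_i\otimes b_j$, $r_{12}\diamond r_{23}=\sum_{i,j}a_i\otimes b_i\diamond a_j\otimes b_j$, $r_{13}\diamond r_{23}=\sum_{i,j}a_i\otimes a_j\otimes b_i\diamond b_j$. Relative Poisson coalgebra $(A,\Delta,\delta,Q)$. Linear maps $\Delta,\delta:A\to A\otimes A$, $Q:A\to A$ with $\tau\Delta=\Delta$, $(\mathrm{id}\otimes\Delta)\Delta=(\Delta\otimes\mathrm{id})\Delta$; $\tau\delta=-\delta$,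 $(\mathrm{id}+\xi+\xi^2)(\mathrm{id}\otimes\delta)\delta=0$ where $\xi(x\otimes y\otimes z)=y\otimes z\otimes x$; $\Delta Q=(Q\otimes\mathrm{id}+\mathrm{id}\otimes Q)\Delta$; $\delta Q=(Q\otimes\mathrm{id}+\mathrm{id}\otimes Q)\delta$; and $(\mathrm{id}\otimes\Delta)\delta(x)-(\delta\otimes\mathrm{id})\Delta(x)-(\tau\otimes\mathrm{id})(\mathrm{id}\otimes\delta)\Delta(x)-(Q\otimes\mathrm{id}\otimes\mathrm{id})(\Delta\otimes\mathrm{id})\Delta(x)=0$ for all $x\in A$. Relative Poisson bialgebra $(A,\cdot,[-,-],\Delta,\delta,P,Q)$. $(A,\cdot,[-,-],P)$ is a relative Poisson algebra; $(A,\Delta,\delta,Q)$ is a relative Poisson coalgebra; $Q$ dually represents $(A,P)$; $\Delta P=(P\otimes\mathrm{id}-\mathrm{id}\otimes Q)\Delta$, $\delta P=(P\otimes\mathrm{id}-\mathrm{id}\otimes Q)\delta$, $(\Delta\otimes\mathrm{id})\Delta(P+Q)=0$ (that is, $P^*$ dually represents the dual relative Poisson algebra $(A^*,Q^* )$); and for all $x,y\in A$: $\Delta(x\cdot y)=(\mathcal L(x)\otimes\mathrm{id})\Delta(y)+(\mathrm{id}\otimes\mathcal L(y))\Delta(x)$; $\delta([x,y])=(\mathrm{ad}(x)\otimes\mathrm{id}+\mathrm{id}\otimes\mathrm{ad}(x))\delta(y)-(\mathrm{ad}(y)\otimes\mathrm{id}+\mathrm{id}\otimes\mathrm{ad}(y))\delta(x)$;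 $\delta(x\cdot y)-(\mathrm{id}\otimes\mathrm{ad}(y))\Delta(x)-(\mathcal L(x)\otimes\mathrm{id})\delta(y)-(\mathrm{id}\otimes\mathrm{ad}(x))\Delta(y)-(\mathcal L(y)\otimes\mathrm{id})\delta(x)-(\mathrm{id}\otimes Q)\Delta(x\cdot y)=0$; $\Delta([x,y])-(\mathcal L(y)\otimes\mathrm{id})\delta(x)-(\mathrm{id}\otimes\mathrm{ad}(x))\Delta(y)+(\mathrm{id}\otimes\mathcal L(y))\delta(x)-(\mathrm{ad}(x)\otimes\mathrm{id})\Delta(y)+\Delta(P(x)\cdot y)=0$. It is coboundary if there is $r\in A\otimes A$ such that $\Delta,\delta$ are given by the two formulas displayed in the claim. *)

theory Defs
  imports "HOL-Computational_Algebra.Polynomial" "HOL-Library.Function_Algebras"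
begin

section \<open>Multilinear maps\<close>

definition bilinear_map ::
  "('k::field \<Rightarrow> 'a::ab_group_add \<Rightarrow> 'a) \<Rightarrow> ('k \<Rightarrow> 'b::ab_group_add \<Rightarrow> 'b) \<Rightarrow>
   ('k \<Rightarrow> 'c::ab_group_add \<Rightarrow> 'c) \<Rightarrow> ('a \<Rightarrow> 'b \<Rightarrow> 'c) \<Rightarrow> bool" where
  "bilinear_map s1 s2 s3 f \<longleftrightarrow>
     (\<forall>x. Vector_Spaces.linear s2 s3 (\<lambda>y. f x y)) \<and>
     (\<forall>y. Vector_Spaces.linear s1 s3 (\<lambda>x. f x y))"

definition trilinear_map ::
  "('k::field \<Rightarrow> 'a::ab_group_add \<Rightarrow> 'a) \<Rightarrow> ('k \<Rightarrow> 'c::ab_group_add \<Rightarrow> 'c) \<Rightarrow>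
   ('a \<Rightarrow> 'a \<Rightarrow> 'a \<Rightarrow> 'c) \<Rightarrow> bool" where
  "trilinear_map s s' f \<longleftrightarrow>
     (\<forall>x y. Vector_Spaces.linear s s' (\<lambda>z. f x y z)) \<and>
     (\<forall>x z. Vector_Spaces.linear s s' (\<lambda>y. f x y z)) \<and>
     (\<forall>y z. Vector_Spaces.linear s s' (\<lambda>x. f x y z))"

abbreviation bilinear_form where
  "bilinear_form s B \<equiv> bilinear_map s s (*) B"

abbreviation trilinear_form where
  "trilinear_form s M \<equiv> trilinear_map s (*) M"


section \<open>The tensor powers \<open>A \<otimes> A\<close> and \<open>A \<otimes> A \<otimes> A\<close>\<close>

text \<open>
  A tensor is represented by its values on multilinear forms: the pure tensor of \<open>x\<close> and \<open>y\<close>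
  is the functional \<open>B \<mapsto> B x y\<close> on bilinear forms (extended by \<open>0\<close> to all other functions, so that
  equality of tensors is equality in HOL), and \<open>A \<otimes> A\<close> is the span of the pure tensors.
  The lemmas \<open>tensor2_universal\<close> and \<open>tensor3_universal\<close> below show that these
  spaces have the universal property of the tensor product.
  Vector space operations on functionals are pointwise.
\<close>

type_synonym ('a, 'k) tens2 = "('a \<Rightarrow> 'a \<Rightarrow> 'k) \<Rightarrow> 'k"
type_synonym ('a, 'k) tens3 = "('a \<Rightarrow> 'a \<Rightarrow> 'a \<Rightarrow> 'k) \<Rightarrow> 'k"

definition fscale :: "'k::field \<Rightarrow> ('m \<Rightarrow> 'k) \<Rightarrow> 'm \<Rightarrow> 'k" where
  "fscale c t = (\<lambda>M. c * t M)"

definition tensor2 ::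
  "('k::field \<Rightarrow> 'a::ab_group_add \<Rightarrow> 'a) \<Rightarrow> 'a \<Rightarrow> 'a \<Rightarrow> ('a, 'k) tens2" where
  "tensor2 s x y = (\<lambda>B. if bilinear_form s B then B x y else 0)"

definition tensor3 ::
  "('k::field \<Rightarrow> 'a::ab_group_add \<Rightarrow> 'a) \<Rightarrow> 'a \<Rightarrow> 'a \<Rightarrow> 'a \<Rightarrow> ('a, 'k) tens3" where
  "tensor3 s x y z = (\<lambda>M. if trilinear_form s M then M x y z else 0)"

definition tensors2 ::
  "('k::field \<Rightarrow> 'a::ab_group_add \<Rightarrow> 'a) \<Rightarrow> ('a, 'k) tens2 set" where
  "tensors2 s = module.span fscale {tensor2 s x y | x y. True}"

definition tensors3 ::
  "('k::field \<Rightarrow> 'a::ab_group_add \<Rightarrow> 'a) \<Rightarrow> ('a, 'k) tens3 set" where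
  "tensors3 s = module.span fscale {tensor3 s x y z | x y z. True}"

text \<open>
  \<open>lift2 b\<close> is the linear map on \<open>A \<otimes> A\<close> induced by a bilinear map \<open>b\<close> with values in
  a space of functionals, i.e. \<open>\<Sum>\<^sub>i a\<^sub>i \<otimes> b\<^sub>i \<mapsto> \<Sum>\<^sub>i b a\<^sub>i b\<^sub>i\<close> (lemma \<open>lift2_sum\<close>);
  similarly for \<open>lift3\<close>.
\<close>

definition lift2 :: "('a \<Rightarrow> 'a \<Rightarrow> 'm \<Rightarrow> 'k) \<Rightarrow> ('a, 'k) tens2 \<Rightarrow> 'm \<Rightarrow> 'k" where
  "lift2 b t = (\<lambda>M. t (\<lambda>x y. b x y M))"

definition lift3 :: "('a \<Rightarrow> 'a \<Rightarrow> 'a \<Rightarrow> 'm \<Rightarrow> 'k) \<Rightarrow> ('a, 'k) tens3 \<Rightarrow> 'm \<Rightarrow> 'k" where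
  "lift3 b t = (\<lambda>M. t (\<lambda>x y z. b x y z M))"

text \<open>\<open>f \<otimes> g\<close> and \<open>f \<otimes> g \<otimes> h\<close> for linear endomorphisms of \<open>A\<close>.\<close>

definition tmap2 ::
  "('k::field \<Rightarrow> 'a::ab_group_add \<Rightarrow> 'a) \<Rightarrow> ('a \<Rightarrow> 'a) \<Rightarrow> ('a \<Rightarrow> 'a) \<Rightarrow>
   ('a, 'k) tens2 \<Rightarrow> ('a, 'k) tens2" where
  "tmap2 s f g = lift2 (\<lambda>x y. tensor2 s (f x) (g y))"

definition tmap3 ::
  "('k::field \<Rightarrow> 'a::ab_group_add \<Rightarrow> 'a) \<Rightarrow> ('a \<Rightarrow> 'a) \<Rightarrow> ('a \<Rightarrow> 'a) \<Rightarrow> ('a \<Rightarrow> 'a) \<Rightarrow>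
   ('a, 'k) tens3 \<Rightarrow> ('a, 'k) tens3" where
  "tmap3 s f g h = lift3 (\<lambda>x y z. tensor3 s (f x) (g y) (h z))"

text \<open>\<open>id \<otimes> D\<close> and \<open>D \<otimes> id\<close> as maps from \<open>A \<otimes> A\<close> to \<open>A \<otimes> A \<otimes> A\<close>, for \<open>D\<close> from \<open>A\<close> to
  \<open>A \<otimes> A\<close>: the inner lifts are \<open>x \<otimes> D(y)\<close> and \<open>D(x) \<otimes> y\<close>.\<close>

definition id_tensor ::
  "('k::field \<Rightarrow> 'a::ab_group_add \<Rightarrow> 'a) \<Rightarrow> ('a \<Rightarrow> ('a, 'k) tens2) \<Rightarrow>
   ('a, 'k) tens2 \<Rightarrow> ('a, 'k) tens3" where
  "id_tensor s D = lift2 (\<lambda>x y. lift2 (\<lambda>u v. tensor3 s x u v) (D y))"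

definition tensor_id ::
  "('k::field \<Rightarrow> 'a::ab_group_add \<Rightarrow> 'a) \<Rightarrow> ('a \<Rightarrow> ('a, 'k) tens2) \<Rightarrow>
   ('a, 'k) tens2 \<Rightarrow> ('a, 'k) tens3" where
  "tensor_id s D = lift2 (\<lambda>x y. lift2 (\<lambda>u v. tensor3 s u v y) (D x))"

definition tau ::
  "('k::field \<Rightarrow> 'a::ab_group_add \<Rightarrow> 'a) \<Rightarrow> ('a, 'k) tens2 \<Rightarrow> ('a, 'k) tens2" where
  "tau s = lift2 (\<lambda>x y. tensor2 s y x)"

definition tau_id ::
  "('k::field \<Rightarrow> 'a::ab_group_add \<Rightarrow> 'a) \<Rightarrow> ('a, 'k) tens3 \<Rightarrow> ('a, 'k) tens3" where
  "tau_id s = lift3 (\<lambda>x y z. tensor3 s y x z)"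

definition xi ::
  "('k::field \<Rightarrow> 'a::ab_group_add \<Rightarrow> 'a) \<Rightarrow> ('a, 'k) tens3 \<Rightarrow> ('a, 'k) tens3" where
  "xi s = lift3 (\<lambda>x y z. tensor3 s y z x)"

text \<open>In the following, \<open>r = \<Sum>\<^sub>i a\<^sub>i \<otimes> b\<^sub>i\<close>; the outer lift runs over \<open>a\<^sub>i \<otimes> b\<^sub>i\<close>, the inner one
  over \<open>a\<^sub>j \<otimes> b\<^sub>j\<close>.\<close>

definition r12_r13 ::
  "('k::field \<Rightarrow> 'a::ab_group_add \<Rightarrow> 'a) \<Rightarrow> ('a \<Rightarrow> 'a \<Rightarrow> 'a) \<Rightarrow> ('a, 'k) tens2 \<Rightarrow> ('a, 'k) tens3" where
  "r12_r13 s dm r = lift2 (\<lambda>ai bi. lift2 (\<lambda>aj bj. tensor3 s (dm ai aj) bi bj) r) r"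

definition r12_r23 ::
  "('k::field \<Rightarrow> 'a::ab_group_add \<Rightarrow> 'a) \<Rightarrow> ('a \<Rightarrow> 'a \<Rightarrow> 'a) \<Rightarrow> ('a, 'k) tens2 \<Rightarrow> ('a, 'k) tens3" where
  "r12_r23 s dm r = lift2 (\<lambda>ai bi. lift2 (\<lambda>aj bj. tensor3 s ai (dm bi aj) bj) r) r"

definition r13_r23 ::
  "('k::field \<Rightarrow> 'a::ab_group_add \<Rightarrow> 'a) \<Rightarrow> ('a \<Rightarrow> 'a \<Rightarrow> 'a) \<Rightarrow> ('a, 'k) tens2 \<Rightarrow> ('a, 'k) tens3" where
  "r13_r23 s dm r = lift2 (\<lambda>ai bi. lift2 (\<lambda>aj bj. tensor3 s ai aj (dm bi bj)) r) r"


section \<open>Relative Poisson algebras, coalgebras and bialgebras\<close>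

locale relative_poisson_algebra = vector_space scale
  for scale :: "'k::field \<Rightarrow> 'a::ab_group_add \<Rightarrow> 'a" +
  fixes mul :: "'a \<Rightarrow> 'a \<Rightarrow> 'a" (infixl "\<cdot>" 70)
    and brk :: "'a \<Rightarrow> 'a \<Rightarrow> 'a"
    and P :: "'a \<Rightarrow> 'a"
  assumes mul_bilinear: "bilinear_map scale scale scale mul"
    and mul_commute: "x \<cdot> y = y \<cdot> x"
    and mul_assoc: "(x \<cdot> y) \<cdot> z = x \<cdot> (y \<cdot> z)"
    and brk_bilinear: "bilinear_map scale scale scale brk"
    and brk_alternating: "brk x x = 0"
    and jacobi: "brk x (brk y z) + brk y (brk z x) + brk z (brk x y) = 0"
    and P_linear: "Vector_Spaces.linear scale scale P"
    and P_mul: "P (x \<cdot> y) = P x \<cdot> y + x \<cdot> P y"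
    and P_brk: "P (brk x y) = brk (P x) y + brk x (P y)"
    and relative_leibniz: "brk z (x \<cdot> y) = brk z x \<cdot> y + x \<cdot> brk z y + x \<cdot> y \<cdot> P z"

definition dually_represents ::
  "('k::field \<Rightarrow> 'a::ab_group_add \<Rightarrow> 'a) \<Rightarrow> ('a \<Rightarrow> 'a \<Rightarrow> 'a) \<Rightarrow> ('a \<Rightarrow> 'a \<Rightarrow> 'a) \<Rightarrow>
   ('a \<Rightarrow> 'a) \<Rightarrow> ('a \<Rightarrow> 'a) \<Rightarrow> bool" where
  "dually_represents scale mul brk P Q \<longleftrightarrow>
     Vector_Spaces.linear scale scale Q \<and>
     (\<forall>x y. mul x (Q y) - mul (P x) y - Q (mul x y) = 0) \<and>
     (\<forall>x y. brk x (Q y) - brk (P x) y - Q (brk x y) = 0) \<and>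
     (\<forall>x y z. brk x (mul y z) + brk y (mul z x) + brk z (mul x y) + Q (mul (mul x y) z) = 0)"

locale relative_poisson_coalgebra = vector_space scale
  for scale :: "'k::field \<Rightarrow> 'a::ab_group_add \<Rightarrow> 'a" +
  fixes \<Delta> :: "'a \<Rightarrow> ('a, 'k) tens2"
    and \<delta> :: "'a \<Rightarrow> ('a, 'k) tens2"
    and Q :: "'a \<Rightarrow> 'a"
  assumes Delta_linear: "Vector_Spaces.linear scale fscale \<Delta>"
    and Delta_tensor: "\<Delta> x \<in> tensors2 scale"
    and delta_linear: "Vector_Spaces.linear scale fscale \<delta>"
    and delta_tensor: "\<delta> x \<in> tensors2 scale"
    and Q_linear: "Vector_Spaces.linear scale scale Q"
    and cocommute: "tau scale (\<Delta> x) = \<Delta> x"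
    and coassoc: "id_tensor scale \<Delta> (\<Delta> x) = tensor_id scale \<Delta> (\<Delta> x)"
    and coantisym: "tau scale (\<delta> x) = - \<delta> x"
    and cojacobi:
      "id_tensor scale \<delta> (\<delta> x) + xi scale (id_tensor scale \<delta> (\<delta> x))
        + xi scale (xi scale (id_tensor scale \<delta> (\<delta> x))) = 0"
    and Delta_Q: "\<Delta> (Q x) = tmap2 scale Q id (\<Delta> x) + tmap2 scale id Q (\<Delta> x)"
    and delta_Q: "\<delta> (Q x) = tmap2 scale Q id (\<delta> x) + tmap2 scale id Q (\<delta> x)"
    and corelative_leibniz:
      "id_tensor scale \<Delta> (\<delta> x) - tensor_id scale \<delta> (\<Delta> x)
        - tau_id scale (id_tensor scale \<delta> (\<Delta> x))
        - tmap3 scale Q id id (tensor_id scale \<Delta> (\<Delta> x)) = 0"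

locale relative_poisson_bialgebra =
  relative_poisson_algebra scale mul brk P + relative_poisson_coalgebra scale \<Delta> \<delta> Q
  for scale :: "'k::field \<Rightarrow> 'a::ab_group_add \<Rightarrow> 'a"
    and mul :: "'a \<Rightarrow> 'a \<Rightarrow> 'a" (infixl "\<cdot>" 70)
    and brk :: "'a \<Rightarrow> 'a \<Rightarrow> 'a"
    and \<Delta> :: "'a \<Rightarrow> ('a, 'k) tens2"
    and \<delta> :: "'a \<Rightarrow> ('a, 'k) tens2"
    and P :: "'a \<Rightarrow> 'a"
    and Q :: "'a \<Rightarrow> 'a" +
  assumes Q_dual: "dually_represents scale mul brk P Q"
    and Delta_P: "\<Delta> (P x) = tmap2 scale P id (\<Delta> x) - tmap2 scale id Q (\<Delta> x)"
    and delta_P: "\<delta> (P x) = tmap2 scale P id (\<delta> x) - tmap2 scale id Q (\<delta> x)"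
    and Delta_Delta_PQ: "tensor_id scale \<Delta> (\<Delta> (P x + Q x)) = 0"
    and Delta_mul:
      "\<Delta> (x \<cdot> y) = tmap2 scale (mul x) id (\<Delta> y) + tmap2 scale id (mul y) (\<Delta> x)"
    and delta_brk:
      "\<delta> (brk x y) =
        (tmap2 scale (brk x) id (\<delta> y) + tmap2 scale id (brk x) (\<delta> y))
        - (tmap2 scale (brk y) id (\<delta> x) + tmap2 scale id (brk y) (\<delta> x))"
    and delta_mul:
      "\<delta> (x \<cdot> y) - tmap2 scale id (brk y) (\<Delta> x) - tmap2 scale (mul x) id (\<delta> y)
        - tmap2 scale id (brk x) (\<Delta> y) - tmap2 scale (mul y) id (\<delta> x)
        - tmap2 scale id Q (\<Delta> (x \<cdot> y)) = 0"
    and Delta_brk: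
      "\<Delta> (brk x y) - tmap2 scale (mul y) id (\<delta> x) - tmap2 scale id (brk x) (\<Delta> y)
        + tmap2 scale id (mul y) (\<delta> x) - tmap2 scale (brk x) id (\<Delta> y)
        + \<Delta> (P x \<cdot> y) = 0"

definition coboundary_Delta ::
  "('k::field \<Rightarrow> 'a::ab_group_add \<Rightarrow> 'a) \<Rightarrow> ('a \<Rightarrow> 'a \<Rightarrow> 'a) \<Rightarrow> ('a, 'k) tens2 \<Rightarrow>
   'a \<Rightarrow> ('a, 'k) tens2" where
  "coboundary_Delta scale mul r x = tmap2 scale id (mul x) r - tmap2 scale (mul x) id r"

definition coboundary_delta ::
  "('k::field \<Rightarrow> 'a::ab_group_add \<Rightarrow> 'a) \<Rightarrow> ('a \<Rightarrow> 'a \<Rightarrow> 'a) \<Rightarrow> ('a, 'k) tens2 \<Rightarrow>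
   'a \<Rightarrow> ('a, 'k) tens2" where
  "coboundary_delta scale brk r x = tmap2 scale (brk x) id r + tmap2 scale id (brk x) r"

definition coboundary_relative_poisson_bialgebra ::
  "('k::field \<Rightarrow> 'a::ab_group_add \<Rightarrow> 'a) \<Rightarrow> ('a \<Rightarrow> 'a \<Rightarrow> 'a) \<Rightarrow> ('a \<Rightarrow> 'a \<Rightarrow> 'a) \<Rightarrow>
   ('a \<Rightarrow> ('a, 'k) tens2) \<Rightarrow> ('a \<Rightarrow> ('a, 'k) tens2) \<Rightarrow> ('a \<Rightarrow> 'a) \<Rightarrow> ('a \<Rightarrow> 'a) \<Rightarrow> bool" where
  "coboundary_relative_poisson_bialgebra scale mul brk \<Delta> \<delta> P Q \<longleftrightarrow>
     relative_poisson_bialgebra scale mul brk \<Delta> \<delta> P Q \<and>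
     (\<exists>r \<in> tensors2 scale. \<Delta> = coboundary_Delta scale mul r \<and> \<delta> = coboundary_delta scale brk r)"


section \<open>The universal property of the tensor powers\<close>

lemma fscale_vector_space: "vector_space fscale"
  by unfold_locales (auto simp: fscale_def fun_eq_iff algebra_simps)

lemma mult_vector_space: "vector_space ((*) :: 'k::field \<Rightarrow> 'k \<Rightarrow> 'k)"
  by unfold_locales (auto simp: algebra_simps)

lemma vs_linear_iff:
  assumes "vector_space s1" "vector_space s2"
  shows "Vector_Spaces.linear s1 s2 f \<longleftrightarrow>
    (\<forall>x y. f (x + y) = f x + f y) \<and> (\<forall>c x. f (s1 c x) = s2 c (f x))"
  using assms
  by (simp add: Vector_Spaces.linear_def module_hom_def module_hom_axioms_def
      vector_space_def module_def)

lemma linear_fscaleI: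
  assumes "\<And>t u. f (t + u) = f t + f u" "\<And>c t. f (fscale c t) = fscale c (f t)"
  shows "Vector_Spaces.linear fscale fscale f"
  using assms by (simp add: vs_linear_iff[OF fscale_vector_space fscale_vector_space])

lemma linear_eval: "Vector_Spaces.linear fscale (*) (\<lambda>t. t M)"
  by (simp add: vs_linear_iff[OF fscale_vector_space mult_vector_space] fscale_def)

lemma lift2_linear: "Vector_Spaces.linear fscale fscale (lift2 b)"
  by (rule linear_fscaleI) (auto simp: lift2_def fscale_def)

lemma lift3_linear: "Vector_Spaces.linear fscale fscale (lift3 b)"
  by (rule linear_fscaleI) (auto simp: lift3_def fscale_def)

lemma lift2_tensor2:
  assumes "\<And>M. bilinear_form s (\<lambda>x y. b x y M)"
  shows "lift2 b (tensor2 s x y) = b x y"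
  using assms by (simp add: lift2_def tensor2_def)

lemma lift3_tensor3:
  assumes "\<And>M. trilinear_form s (\<lambda>x y z. b x y z M)"
  shows "lift3 b (tensor3 s x y z) = b x y z"
  using assms by (simp add: lift3_def tensor3_def)

lemma lift2_sum:
  assumes "\<And>M. bilinear_form s (\<lambda>x y. b x y M)"
  shows "lift2 b (\<Sum>i\<in>I. tensor2 s (f i) (g i)) = (\<Sum>i\<in>I. b (f i) (g i))"
proof -
  interpret module_hom fscale fscale "lift2 b"
    using lift2_linear[of b] by (simp add: Vector_Spaces.linear_def)
  show ?thesis
    by (simp add: sum lift2_tensor2[OF assms])
qed

lemma universal_aux:
  fixes e :: "'i \<Rightarrow> 'm \<Rightarrow> 'k::field" and b :: "'i \<Rightarrow> 'w::ab_group_add"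
    and sw :: "'k \<Rightarrow> 'w \<Rightarrow> 'w"
  assumes W: "vector_space sw"
    and sep: "\<And>\<phi>. Vector_Spaces.linear sw (*) \<phi> \<Longrightarrow> \<exists>M. \<forall>i. e i M = \<phi> (b i)"
  shows "\<exists>h. Vector_Spaces.linear fscale sw h \<and> (\<forall>i. h (e i) = b i)"
proof -
  interpret fw: vector_space_pair fscale sw
    using W fscale_vector_space by (simp add: vector_space_pair_def)
  interpret wk: vector_space_pair sw "(*) :: 'k \<Rightarrow> 'k \<Rightarrow> 'k"
    using W mult_vector_space by (simp add: vector_space_pair_def)
  interpret fk: vector_space_pair fscale "(*) :: 'k \<Rightarrow> 'k \<Rightarrow> 'k"
    using fscale_vector_space mult_vector_space by (simp add: vector_space_pair_def)
  obtain E where E: "E \<subseteq> range e" "fw.vs1.independent E" "range e \<subseteq> fw.vs1.span E"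
    using fw.vs1.maximal_independent_subset[of "range e"] by metis
  have "\<exists>j. \<forall>t\<in>E. e (j t) = t"
    using E(1) by (metis f_inv_into_f subsetD)
  then obtain j where j: "\<And>t. t \<in> E \<Longrightarrow> e (j t) = t" by blast
  obtain h where h: "Vector_Spaces.linear fscale sw h" "\<And>t. t \<in> E \<Longrightarrow> h t = b (j t)"
    using fw.linear_independent_extend[OF E(2), of "\<lambda>t. b (j t)"] by blast
  have "h (e i) = b i" for i
  proof (rule ccontr)
    assume "h (e i) \<noteq> b i"
    then have "fw.vs2.independent {h (e i) - b i}" by simp
    from wk.linear_independent_extend[OF this, of "\<lambda>_. 1"]
    obtain \<phi> where \<phi>: "Vector_Spaces.linear sw (*) \<phi>" "\<phi> (h (e i) - b i) = 1" by auto
    obtain M where M: "\<And>i. e i M = \<phi> (b i)" using sep[OF \<phi>(1)] by blast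
    have "Vector_Spaces.linear fscale (*) (\<phi> \<circ> h)"
      using Vector_Spaces.linear_compose[OF h(1) \<phi>(1)] .
    moreover have "(\<phi> \<circ> h) t = t M" if "t \<in> E" for t
      using h(2)[OF that] M[of "j t"] j[OF that] by simp
    ultimately have "(\<phi> \<circ> h) (e i) = e i M"
      using fk.linear_eq_on_span[OF _ linear_eval[of M], of "\<phi> \<circ> h" E "e i"] E(3) by blast
    then have "\<phi> (h (e i)) = \<phi> (b i)" using M by simp
    then show False
      using \<phi>(2) wk.linear_diff[OF \<phi>(1), of "h (e i)" "b i"] by simp
  qed
  then show ?thesis using h(1) by blast
qed

lemma linear_compose_apply:
  assumes "Vector_Spaces.linear s3 s4 f" "Vector_Spaces.linear s s3 g"
  shows "Vector_Spaces.linear s s4 (\<lambda>x. f (g x))"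
  using Vector_Spaces.linear_compose[OF assms(2,1)] by (simp add: o_def)

lemma bilinear_map_compose:
  assumes "bilinear_map s1 s2 s3 b" "Vector_Spaces.linear s3 s4 f"
  shows "bilinear_map s1 s2 s4 (\<lambda>x y. f (b x y))"
  unfolding bilinear_map_def
  by (intro conjI allI; rule linear_compose_apply[OF assms(2)];
      insert assms(1); simp add: bilinear_map_def)

lemma trilinear_map_compose:
  assumes "trilinear_map s s3 b" "Vector_Spaces.linear s3 s4 f"
  shows "trilinear_map s s4 (\<lambda>x y z. f (b x y z))"
  unfolding trilinear_map_def
  by (intro conjI allI; rule linear_compose_apply[OF assms(2)];
      insert assms(1); simp add: trilinear_map_def)

lemma tensor2_bilinear:
  assumes "vector_space s"
  shows "bilinear_map s s fscale (tensor2 s)"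
  by (auto simp: bilinear_map_def vs_linear_iff[OF assms fscale_vector_space]
      vs_linear_iff[OF assms mult_vector_space] tensor2_def fscale_def fun_eq_iff)

lemma tensor3_trilinear:
  assumes "vector_space s"
  shows "trilinear_map s fscale (tensor3 s)"
  by (auto simp: trilinear_map_def vs_linear_iff[OF assms fscale_vector_space]
      vs_linear_iff[OF assms mult_vector_space] tensor3_def fscale_def fun_eq_iff)

theorem tensor2_universal:
  assumes "vector_space sw" "bilinear_map s s sw b"
  shows "\<exists>h. Vector_Spaces.linear fscale sw h \<and> (\<forall>x y. h (tensor2 s x y) = b x y)"
    and "\<lbrakk>Vector_Spaces.linear fscale sw h; Vector_Spaces.linear fscale sw h';
          \<And>x y. h (tensor2 s x y) = h' (tensor2 s x y); t \<in> tensors2 s\<rbrakk> \<Longrightarrow> h t = h' t"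
proof -
  have "\<exists>h. Vector_Spaces.linear fscale sw h \<and>
      (\<forall>i. h (case_prod (tensor2 s) i) = case_prod b i)"
  proof (rule universal_aux[OF assms(1)])
    fix \<phi> assume "Vector_Spaces.linear sw (*) \<phi>"
    then have "\<forall>i. case_prod (tensor2 s) i (\<lambda>x y. \<phi> (b x y)) = \<phi> (case_prod b i)"
      using bilinear_map_compose[OF assms(2), of "(*)" \<phi>] by (auto simp: tensor2_def)
    then show "\<exists>M. \<forall>i. case_prod (tensor2 s) i M = \<phi> (case_prod b i)" by blast
  qed
  then show "\<exists>h. Vector_Spaces.linear fscale sw h \<and> (\<forall>x y. h (tensor2 s x y) = b x y)" by auto
next
  interpret vector_space_pair fscale sw
    using assms(1) fscale_vector_space by (simp add: vector_space_pair_def)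
  show "h t = h' t"
    if "Vector_Spaces.linear fscale sw h" "Vector_Spaces.linear fscale sw h'"
      "\<And>x y. h (tensor2 s x y) = h' (tensor2 s x y)" "t \<in> tensors2 s"
    using linear_eq_on_span[OF that(1,2) _ that(4)[unfolded tensors2_def]] that(3) by blast
qed

theorem tensor3_universal:
  assumes "vector_space sw" "trilinear_map s sw b"
  shows "\<exists>h. Vector_Spaces.linear fscale sw h \<and> (\<forall>x y z. h (tensor3 s x y z) = b x y z)"
    and "\<lbrakk>Vector_Spaces.linear fscale sw h; Vector_Spaces.linear fscale sw h';
          \<And>x y z. h (tensor3 s x y z) = h' (tensor3 s x y z); t \<in> tensors3 s\<rbrakk> \<Longrightarrow> h t = h' t"
proof -
  have "\<exists>h. Vector_Spaces.linear fscale sw h \<and>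
      (\<forall>i. h (case i of (x, y, z) \<Rightarrow> tensor3 s x y z) = (case i of (x, y, z) \<Rightarrow> b x y z))"
  proof (rule universal_aux[OF assms(1)])
    fix \<phi> assume "Vector_Spaces.linear sw (*) \<phi>"
    then have "\<forall>i. (case i of (x, y, z) \<Rightarrow> tensor3 s x y z) (\<lambda>x y z. \<phi> (b x y z))
        = \<phi> (case i of (x, y, z) \<Rightarrow> b x y z)"
      using trilinear_map_compose[OF assms(2), of "(*)" \<phi>] by (auto simp: tensor3_def)
    then show "\<exists>M. \<forall>i. (case i of (x, y, z) \<Rightarrow> tensor3 s x y z) M
        = \<phi> (case i of (x, y, z) \<Rightarrow> b x y z)" by blast
  qed
  then show "\<exists>h. Vector_Spaces.linear fscale sw h \<and> (\<forall>x y z. h (tensor3 s x y z) = b x y z)"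
    by auto
next
  interpret vector_space_pair fscale sw
    using assms(1) fscale_vector_space by (simp add: vector_space_pair_def)
  show "h t = h' t"
    if "Vector_Spaces.linear fscale sw h" "Vector_Spaces.linear fscale sw h'"
      "\<And>x y z. h (tensor3 s x y z) = h' (tensor3 s x y z)" "t \<in> tensors3 s"
    using linear_eq_on_span[OF that(1,2) _ that(4)[unfolded tensors3_def]] that(3) by blast
qed

end

theory Submission
  imports Defs
begin

text \<open>
  Write \<open>r = \<Sum>\<^sub>i a\<^sub>i \<otimes> b\<^sub>i\<close>. A tensor is determined by its values on multilinear forms, and
  the value of \<open>\<Delta>(x)\<close> or \<open>\<delta>(x)\<close> on a form \<open>B\<close> is a sum over \<open>i\<close> of values of \<open>B\<close>
  at \<open>a\<^sub>i\<close> and \<open>b\<^sub>i\<close>. Each bialgebra axiom thus becomes an identity between the sums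
  \<open>contract\<close> (one copy of \<open>r\<close>) or \<open>contract2\<close> (two copies), for an arbitrary form. The
  hypotheses on \<open>r\<close> become rules for such sums: antisymmetry exchanges \<open>a\<^sub>i\<close> and \<open>b\<^sub>i\<close> at the
  price of a sign, the two equations relating \<open>P\<close> and \<open>Q\<close> move \<open>P\<close> from one leg of \<open>r\<close> to the
  other as \<open>Q\<close> and conversely, and the Yang-Baxter equations are three-term relations valid for
  every trilinear form, in particular for one precomposed with \<open>x\<cdot>\<close>, \<open>[x, -]\<close> or \<open>Q\<close> in one slot.

  The axioms with a single coproduct use one copy of \<open>r\<close>. They follow from the identities of \<open>A\<close>
  applied in each leg separately, together with antisymmetry for the (co)symmetry of the coproducts
  and the \<open>P\<close>-\<open>Q\<close> rules for the terms in which \<open>P\<close> or \<open>Q\<close> acts on a leg of \<open>r\<close>.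

  The axioms that compose two coproducts use two copies. In these the terms are sorted
  according to the slot of the trilinear form that contains \<open>x\<close>, and the terms of each slot cancel
  by themselves. Coassociativity is the associative Yang-Baxter equation, once with \<open>x\<close> in the last
  slot and once with \<open>x\<close> in the first. Co-Jacobi is the classical Yang-Baxter equation followed by
  the Jacobi identity. The compatibility of \<open>\<Delta>\<close> and \<open>\<delta>\<close> (\<open>corelative_leibniz\<close>) needs both
  equations, and the error terms \<open>x \<cdot> y \<cdot> P z\<close> of the relative Leibniz rule are turned by the
  \<open>P\<close>-\<open>Q\<close> rules into the terms of \<open>(Q \<otimes> id \<otimes> id)(\<Delta> \<otimes> id)\<Delta>\<close>. Finally
  \<open>(\<Delta> \<otimes> id)\<Delta>(P + Q) = 0\<close> holds because \<open>(P + Q)(x)\<close> annihilates all products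
  (\<open>P_plus_Q_mul_mul\<close>).
\<close>

section \<open>Evaluating tensors on multilinear forms\<close>

lemma bilinear_form_iff:
  assumes "vector_space s"
  shows "bilinear_form s B \<longleftrightarrow>
    (\<forall>x y z. B x (y + z) = B x y + B x z) \<and> (\<forall>c x y. B x (s c y) = c * B x y) \<and>
    (\<forall>x y z. B (x + y) z = B x z + B y z) \<and> (\<forall>c x y. B (s c x) y = c * B x y)"
  by (auto simp: bilinear_map_def vs_linear_iff[OF assms mult_vector_space])

lemma trilinear_form_iff:
  assumes "vector_space s"
  shows "trilinear_form s M \<longleftrightarrow>
    (\<forall>u. bilinear_form s (M u)) \<and> (\<forall>v. bilinear_form s (\<lambda>u w. M u v w))"
  by (auto simp: trilinear_map_def bilinear_map_def)

lemma linear_rules: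
  assumes "Vector_Spaces.linear s s' f"
  shows "f (x + y) = f x + f y" "f (s c x) = s' c (f x)" "f (- x) = - f x"
    "f (x - y) = f x - f y" "f 0 = 0"
proof -
  interpret Vector_Spaces.linear s s' f by (rule assms)
  show "f (x + y) = f x + f y" "f (s c x) = s' c (f x)" "f (- x) = - f x"
    "f (x - y) = f x - f y" "f 0 = 0"
    by (rule add scale neg diff zero)+
qed

text \<open>
  In an argument other than the last, additivity and homogeneity are equations between functions.
  They then also rewrite a partially applied form, which arises by eta-contraction when a form is
  summed over its last argument.
\<close>

lemma bilinear_rules:
  assumes "bilinear_map s1 s2 s' f"
  shows "f x (y + z) = f x y + f x z" "f x (s2 c y) = s' c (f x y)" "f x (- y) = - f x y"
    "f x (y - z) = f x y - f x z" "f x 0 = 0"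
    "f (x + y) = (\<lambda>z. f x z + f y z)" "f (s1 c x) = (\<lambda>y. s' c (f x y))" "f (- x) = (\<lambda>y. - f x y)"
    "f (x - y) = (\<lambda>z. f x z - f y z)" "f 0 = (\<lambda>y. 0)"
proof -
  have l: "Vector_Spaces.linear s2 s' (f x)" and r: "Vector_Spaces.linear s1 s' (\<lambda>x. f x y)" for x y
    using assms by (auto simp: bilinear_map_def)
  show "f x (y + z) = f x y + f x z" "f x (s2 c y) = s' c (f x y)" "f x (- y) = - f x y"
    "f x (y - z) = f x y - f x z" "f x 0 = 0"
    by (rule linear_rules[OF l])+
  show "f (x + y) = (\<lambda>z. f x z + f y z)" "f (s1 c x) = (\<lambda>y. s' c (f x y))" "f (- x) = (\<lambda>y. - f x y)"
    "f (x - y) = (\<lambda>z. f x z - f y z)" "f 0 = (\<lambda>y. 0)"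
    by (rule ext, rule linear_rules[OF r])+
qed

lemma trilinear_rules:
  assumes "trilinear_map s s' f"
  shows "f u v (x + y) = f u v x + f u v y" "f u v (s c x) = s' c (f u v x)"
    "f u v (- x) = - f u v x" "f u v (x - y) = f u v x - f u v y" "f u v 0 = 0"
    "f u (x + y) = (\<lambda>v. f u x v + f u y v)" "f u (s c x) = (\<lambda>v. s' c (f u x v))"
    "f u (- x) = (\<lambda>v. - f u x v)" "f u (x - y) = (\<lambda>v. f u x v - f u y v)" "f u 0 = (\<lambda>v. 0)"
    "f (x + y) = (\<lambda>u v. f x u v + f y u v)" "f (s c x) = (\<lambda>u v. s' c (f x u v))"
    "f (- x) = (\<lambda>u v. - f x u v)" "f (x - y) = (\<lambda>u v. f x u v - f y u v)" "f 0 = (\<lambda>u v. 0)"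
proof -
  have *: "bilinear_map s s s' (f u)" and "\<And>v. bilinear_map s s s' (\<lambda>x. f x v)" for u
    using assms by (auto simp: bilinear_map_def trilinear_map_def)
  note 23 = bilinear_rules[OF *] and 1 = bilinear_rules(6-10)[OF this(2), THEN fun_cong]
  show "f u v (x + y) = f u v x + f u v y" "f u v (s c x) = s' c (f u v x)"
    "f u v (- x) = - f u v x" "f u v (x - y) = f u v x - f u v y" "f u v 0 = 0"
    "f u (x + y) = (\<lambda>v. f u x v + f u y v)" "f u (s c x) = (\<lambda>v. s' c (f u x v))"
    "f u (- x) = (\<lambda>v. - f u x v)" "f u (x - y) = (\<lambda>v. f u x v - f u y v)" "f u 0 = (\<lambda>v. 0)"
    by (rule 23)+
  show "f (x + y) = (\<lambda>u v. f x u v + f y u v)" "f (s c x) = (\<lambda>u v. s' c (f x u v))"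
    "f (- x) = (\<lambda>u v. - f x u v)" "f (x - y) = (\<lambda>u v. f x u v - f y u v)" "f 0 = (\<lambda>u v. 0)"
    by (intro ext, rule 1)+
qed

lemma sum_functional_apply: "(\<Sum>i\<in>I. f i) x = (\<Sum>i\<in>I. f i x)"
  by (induction I rule: infinite_finite_induct) auto

context
  fixes s :: "'k::field \<Rightarrow> 'a::ab_group_add \<Rightarrow> 'a"
  assumes vs: "vector_space s"
begin

interpretation fs: vector_space "fscale :: 'k \<Rightarrow> ('m \<Rightarrow> 'k) \<Rightarrow> _"
  by (rule fscale_vector_space)

lemma tensors2_as_sum:
  assumes "t \<in> tensors2 s"
  shows "\<exists>n::nat. \<exists>a b. t = (\<Sum>i<n. tensor2 s (a i) (b i))"
  using assms unfolding tensors2_def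
proof (induction t rule: fs.span_induct_alt)
  case base
  show ?case by (rule exI[of _ 0]) simp
next
  case (step c e t)
  then obtain x y and n :: nat and a b
    where e: "e = tensor2 s x y" and t: "t = (\<Sum>i<n. tensor2 s (a i) (b i))" by auto
  have "fscale c e + t = (\<Sum>i<Suc n. tensor2 s ((a(n := s c x)) i) ((b(n := y)) i))"
    by (simp add: e t bilinear_rules[OF tensor2_bilinear[OF vs]] add.commute)
  then show ?case by blast
qed

lemma tensors2_sum: "(\<Sum>i\<in>I. tensor2 s (a i) (b i)) \<in> tensors2 s"
  unfolding tensors2_def by (intro fs.span_sum fs.span_base) blast

lemma tensors2_add: "t \<in> tensors2 s \<Longrightarrow> u \<in> tensors2 s \<Longrightarrow> t + u \<in> tensors2 s"
  and tensors2_diff: "t \<in> tensors2 s \<Longrightarrow> u \<in> tensors2 s \<Longrightarrow> t - u \<in> tensors2 s"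
  and tensors2_fscale: "t \<in> tensors2 s \<Longrightarrow> fscale c t \<in> tensors2 s"
  and tensors2_minus: "t \<in> tensors2 s \<Longrightarrow> - t \<in> tensors2 s"
  and tensors2_zero: "0 \<in> tensors2 s"
  unfolding tensors2_def by (auto intro: fs.span_add fs.span_diff fs.span_scale fs.span_neg fs.span_zero)

lemma tensors2_not_bilinear:
  assumes "t \<in> tensors2 s" "\<not> bilinear_form s B"
  shows "t B = 0"
proof -
  obtain n :: nat and a b where "t = (\<Sum>i<n. tensor2 s (a i) (b i))"
    using tensors2_as_sum[OF assms(1)] by blast
  then show ?thesis
    using assms(2) by (simp add: tensor2_def sum_functional_apply)
qed

text \<open>
  At a form that is not multilinear, the operations on tensors evaluate their argument at the
  zero form.
\<close>

lemma tensors2_zero_form: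
  assumes "t \<in> tensors2 s"
  shows "t (\<lambda>_ _. 0) = 0"
proof -
  obtain n :: nat and a b where "t = (\<Sum>i<n. tensor2 s (a i) (b i))"
    using tensors2_as_sum[OF assms(1)] by blast
  then show ?thesis
    by (simp add: tensor2_def sum_functional_apply)
qed

lemma tensors2_eqI:
  assumes "t \<in> tensors2 s" "u \<in> tensors2 s" "\<And>B. bilinear_form s B \<Longrightarrow> t B = u B"
  shows "t = u"
proof
  fix B
  show "t B = u B"
    using assms(3)[of B] tensors2_not_bilinear[OF assms(1), of B]
      tensors2_not_bilinear[OF assms(2), of B]
    by (cases "bilinear_form s B") simp_all
qed

lemma tau_in_tensors2:
  assumes "t \<in> tensors2 s"
  shows "tau s t \<in> tensors2 s"
proof -
  obtain n :: nat and a b where t: "t = (\<Sum>i<n. tensor2 s (a i) (b i))"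
    using tensors2_as_sum[OF assms] by blast
  have "tau s t = (\<Sum>i<n. tensor2 s (b i) (a i))"
    unfolding t tau_def
    by (rule lift2_sum)
      (simp add: bilinear_form_iff[OF vs] bilinear_rules[OF tensor2_bilinear[OF vs]] fscale_def)
  then show ?thesis by (simp add: tensors2_sum)
qed

lemma tmap2_in_tensors2:
  assumes "t \<in> tensors2 s" "Vector_Spaces.linear s s f" "Vector_Spaces.linear s s g"
  shows "tmap2 s f g t \<in> tensors2 s"
proof -
  obtain n :: nat and a b where t: "t = (\<Sum>i<n. tensor2 s (a i) (b i))"
    using tensors2_as_sum[OF assms(1)] by blast
  have "tmap2 s f g t = (\<Sum>i<n. tensor2 s (f (a i)) (g (b i)))"
    unfolding t tmap2_def
    by (rule lift2_sum)
      (simp add: bilinear_form_iff[OF vs] bilinear_rules[OF tensor2_bilinear[OF vs]] fscale_def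
        linear_rules[OF assms(2)] linear_rules[OF assms(3)])
  then show ?thesis by (simp add: tensors2_sum)
qed

lemma tmap2_apply: "bilinear_form s B \<Longrightarrow> tmap2 s f g t B = t (\<lambda>x y. B (f x) (g y))"
  by (simp add: tmap2_def lift2_def tensor2_def)

lemma tau_apply: "bilinear_form s B \<Longrightarrow> tau s t B = t (\<lambda>x y. B y x)"
  by (simp add: tau_def lift2_def tensor2_def)

lemma id_tensor_apply:
  "trilinear_form s M \<Longrightarrow> id_tensor s D t M = t (\<lambda>x y. D y (M x))"
  by (simp add: id_tensor_def lift2_def tensor3_def)

lemma tensor_id_apply:
  "trilinear_form s M \<Longrightarrow> tensor_id s D t M = t (\<lambda>x y. D x (\<lambda>u v. M u v y))"
  by (simp add: tensor_id_def lift2_def tensor3_def)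

lemma tensor_not_trilinear:
  assumes "\<not> trilinear_form s M" "t \<in> tensors2 s" "\<And>x. D x \<in> tensors2 s"
  shows "id_tensor s D t M = 0" "tensor_id s D t M = 0"
  using assms by (simp_all add: id_tensor_def tensor_id_def lift2_def tensor3_def tensors2_zero_form)

lemma zero_trilinear: "trilinear_form s (\<lambda>x y z. 0)"
  by (simp add: trilinear_form_iff[OF vs] bilinear_form_iff[OF vs])

end

section \<open>Identities in a dually represented relative Poisson algebra\<close>

text \<open>
  A chosen expansion of \<open>r\<close> as a sum of pure tensors is part of the locale, so that
  evaluation at \<open>r\<close> can be replaced by a sum that is additive on all functions; evaluation itself
  is additive on bilinear forms only.
\<close>

locale yang_baxter_solution = relative_poisson_algebra scale mul brk P
  for scale :: "'k::field \<Rightarrow> 'a::ab_group_add \<Rightarrow> 'a"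
    and mul :: "'a \<Rightarrow> 'a \<Rightarrow> 'a" (infixl "\<cdot>" 70)
    and brk :: "'a \<Rightarrow> 'a \<Rightarrow> 'a"
    and P :: "'a \<Rightarrow> 'a" +
  fixes Q :: "'a \<Rightarrow> 'a"
    and r :: "('a, 'k) tens2"
    and n :: nat
    and a b :: "nat \<Rightarrow> 'a"
  assumes Q_dual: "dually_represents scale mul brk P Q"
    and r_sum: "r = (\<Sum>i<n. tensor2 scale (a i) (b i))"
    and antisymmetric: "r + tau scale r = 0"
    and associative_YBE: "r12_r13 scale mul r - r12_r23 scale mul r + r13_r23 scale mul r = 0"
    and classical_YBE: "r12_r13 scale brk r + r12_r23 scale brk r + r13_r23 scale brk r = 0"
    and P_Q: "tmap2 scale P id r - tmap2 scale id Q r = 0"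
    and Q_P: "tmap2 scale Q id r - tmap2 scale id P r = 0"
begin

lemma Q_linear: "Vector_Spaces.linear scale scale Q"
  and Q_mul: "Q (x \<cdot> y) = x \<cdot> Q y - P x \<cdot> y"
  and Q_brk: "Q (brk x y) = brk x (Q y) - brk (P x) y"
  and Q_triple: "brk x (y \<cdot> z) + brk y (z \<cdot> x) + brk z (x \<cdot> y) + Q (x \<cdot> y \<cdot> z) = 0"
  using Q_dual by (auto simp: dually_represents_def algebra_simps)

lemmas mul_rules = bilinear_rules[OF mul_bilinear]
lemmas brk_rules = bilinear_rules[OF brk_bilinear]
lemmas P_rules = linear_rules[OF P_linear]
lemmas Q_rules = linear_rules[OF Q_linear]

lemma brk_anti: "brk x y = - brk y x"
proof -
  have "brk (x + y) (x + y) = brk x x + brk x y + (brk y x + brk y y)"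
    by (simp add: brk_rules)
  then have "brk x y + brk y x = 0"
    unfolding brk_alternating by simp
  then show ?thesis by (simp add: eq_neg_iff_add_eq_0)
qed

lemma mul_left_commute: "x \<cdot> (y \<cdot> z) = y \<cdot> (x \<cdot> z)"
  by (metis mul_assoc mul_commute)

lemmas mul_ac = mul_assoc mul_commute mul_left_commute

lemma Q_mul_left: "Q (x \<cdot> y) = Q x \<cdot> y - x \<cdot> P y"
  using Q_mul[of y x] by (simp add: mul_commute)

lemma Q_brk_left: "Q (brk x y) = brk (Q x) y - brk x (P y)"
proof -
  have "Q (brk x y) = - Q (brk y x)"
    using brk_anti[of x y] by (simp add: Q_rules)
  also have "\<dots> = brk (Q x) y - brk x (P y)"
    unfolding Q_brk using brk_anti[of y "Q x"] brk_anti[of "P y" x] by simp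
  finally show ?thesis .
qed

lemma brk_brk_left: "brk (brk x y) z = brk x (brk y z) - brk y (brk x z)"
proof -
  have "brk (brk x y) z = - brk z (brk x y)" "brk y (brk x z) = - brk y (brk z x)"
    using brk_anti[of "brk x y" z] brk_anti[of x z] by (simp_all add: brk_rules)
  moreover have "brk x (brk y z) + brk y (brk z x) = - brk z (brk x y)"
    using jacobi[of x y z] by (simp add: eq_neg_iff_add_eq_0)
  ultimately show ?thesis by simp
qed

lemma brk_mul_left: "brk (x \<cdot> y) z = x \<cdot> brk y z + y \<cdot> brk x z - x \<cdot> y \<cdot> P z"
  using brk_anti[of "x \<cdot> y" z] brk_anti[of x z] brk_anti[of y z]
  by (simp add: relative_leibniz mul_rules mul_ac)

lemma Q_mul_brk: "Q (x \<cdot> y \<cdot> z) = brk (x \<cdot> y) z - brk x (y \<cdot> z) - brk y (x \<cdot> z)"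
proof -
  have "brk z (x \<cdot> y) = - brk (x \<cdot> y) z" by (rule brk_anti)
  then show ?thesis using Q_triple[of x y z] by (simp add: mul_commute add_eq_0_iff2 algebra_simps)
qed

text \<open>
  Expanding the brackets in \<open>Q_triple\<close> by the relative Leibniz rule, the six terms with a bracket
  cancel in pairs and the remaining three add up to \<open>P (x \<cdot> y \<cdot> z)\<close>.
\<close>

lemma P_plus_Q_triple: "P (x \<cdot> y \<cdot> z) + Q (x \<cdot> y \<cdot> z) = 0"
proof -
  have "brk x (y \<cdot> z) + brk y (z \<cdot> x) + brk z (x \<cdot> y) = P (x \<cdot> y \<cdot> z)"
    using brk_anti[of y x] brk_anti[of z x] brk_anti[of z y]
    by (simp add: relative_leibniz P_mul mul_rules mul_ac)
  then show ?thesis using Q_triple[of x y z] by simp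
qed

lemma P_plus_Q_mul: "(P x + Q x) \<cdot> y = P (x \<cdot> y) + Q (x \<cdot> y)"
  by (simp add: Q_mul_left P_mul mul_rules)

lemma P_plus_Q_mul_mul: "(P x + Q x) \<cdot> y \<cdot> z = 0"
  using P_plus_Q_triple[of x y z] P_plus_Q_mul[of x "y \<cdot> z"] by (simp add: mul_assoc)

section \<open>The hypotheses on \<open>r\<close> as rules for sums\<close>

lemmas form_iffs =
  bilinear_form_iff[OF vector_space_axioms] trilinear_form_iff[OF vector_space_axioms]

definition contract :: "('a \<Rightarrow> 'a \<Rightarrow> 'k) \<Rightarrow> 'k" where
  "contract f = (\<Sum>i<n. f (a i) (b i))"

definition contract2 :: "('a \<Rightarrow> 'a \<Rightarrow> 'a \<Rightarrow> 'a \<Rightarrow> 'k) \<Rightarrow> 'k" where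
  "contract2 F = contract (\<lambda>u v. contract (\<lambda>p q. F u v p q))"

lemma contract_linear:
  "contract (\<lambda>u v. f u v + g u v) = contract f + contract g"
  "contract (\<lambda>u v. f u v - g u v) = contract f - contract g"
  "contract (\<lambda>u v. - f u v) = - contract f"
  "contract (\<lambda>u v. c * f u v) = c * contract f"
  "contract (\<lambda>u v. 0) = 0"
  by (simp_all add: contract_def sum.distrib sum_subtractf sum_negf sum_distrib_left)

lemma contract2_linear:
  "contract2 (\<lambda>u v p q. F u v p q + G u v p q) = contract2 F + contract2 G"
  "contract2 (\<lambda>u v p q. F u v p q - G u v p q) = contract2 F - contract2 G"
  "contract2 (\<lambda>u v p q. - F u v p q) = - contract2 F"
  "contract2 (\<lambda>u v p q. 0) = 0"
  by (simp_all add: contract2_def contract_linear)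

lemma r_in_tensors2: "r \<in> tensors2 scale"
  unfolding r_sum by (rule tensors2_sum[OF vector_space_axioms])

lemma r_apply: "bilinear_form scale B \<Longrightarrow> r B = contract B"
  by (simp add: r_sum sum_functional_apply tensor2_def contract_def)

lemma contract_flip:
  assumes "bilinear_form scale B"
  shows "contract B = - contract (\<lambda>u v. B v u)"
proof -
  have "bilinear_form scale (\<lambda>u v. B v u)" using assms by (simp add: form_iffs)
  moreover have "r B + tau scale r B = 0"
    using fun_cong[OF antisymmetric, of B] by simp
  ultimately show ?thesis
    using assms by (simp add: tau_apply[OF vector_space_axioms] r_apply add_eq_0_iff2)
qed

lemma contract_P:
  assumes "bilinear_form scale B"
  shows "contract (\<lambda>u v. B (P u) v) = contract (\<lambda>u v. B u (Q v))"
proof -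
  have "bilinear_form scale (\<lambda>u v. B (P u) v)" "bilinear_form scale (\<lambda>u v. B u (Q v))"
    using assms by (simp_all add: form_iffs P_rules Q_rules)
  moreover have "tmap2 scale P id r B - tmap2 scale id Q r B = 0"
    using fun_cong[OF P_Q, of B] by simp
  ultimately show ?thesis
    using assms by (simp add: tmap2_apply[OF vector_space_axioms] r_apply)
qed

lemma contract_Q:
  assumes "bilinear_form scale B"
  shows "contract (\<lambda>u v. B (Q u) v) = contract (\<lambda>u v. B u (P v))"
proof -
  have "bilinear_form scale (\<lambda>u v. B (Q u) v)" "bilinear_form scale (\<lambda>u v. B u (P v))"
    using assms by (simp_all add: form_iffs P_rules Q_rules)
  moreover have "tmap2 scale Q id r B - tmap2 scale id P r B = 0"
    using fun_cong[OF Q_P, of B] by simp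
  ultimately show ?thesis
    using assms by (simp add: tmap2_apply[OF vector_space_axioms] r_apply)
qed

lemma contract2_swap: "contract2 F = contract2 (\<lambda>u v p q. F p q u v)"
  unfolding contract2_def contract_def by (rule sum.swap)

lemma contract2_cong:
  assumes "\<And>u v. contract (F u v) = contract (G u v)"
  shows "contract2 F = contract2 G"
  unfolding contract2_def using assms by simp

lemma contract2_flip2:
  assumes "\<And>u v. bilinear_form scale (F u v)"
  shows "contract2 F = - contract2 (\<lambda>u v p q. F u v q p)"
  unfolding contract2_linear(3)[symmetric]
  by (rule contract2_cong) (unfold contract_linear, rule contract_flip[OF assms])

lemma contract2_flip1:
  assumes "\<And>p q. bilinear_form scale (\<lambda>u v. F u v p q)"
  shows "contract2 F = - contract2 (\<lambda>u v p q. F v u p q)"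
  using contract2_flip2[of "\<lambda>u v p q. F p q u v", OF assms]
  unfolding contract2_swap[of "\<lambda>u v p q. F p q u v"] contract2_swap[of "\<lambda>u v p q. F q p u v"] .

lemma contract2_Q1:
  assumes "\<And>p q. bilinear_form scale (\<lambda>u v. F u v p q)"
  shows "contract2 (\<lambda>u v. F (Q u) v) = contract2 (\<lambda>u v. F u (P v))"
proof -
  have "contract2 (\<lambda>u v p q. F (Q p) q u v) = contract2 (\<lambda>u v p q. F p (P q) u v)"
    by (rule contract2_cong) (rule contract_Q, rule assms)
  then show ?thesis
    unfolding contract2_swap[of "\<lambda>u v p q. F (Q p) q u v"]
      contract2_swap[of "\<lambda>u v p q. F p (P q) u v"] .
qed

lemma YB_terms:
  assumes D: "bilinear_map scale scale scale D" and M: "trilinear_form scale M"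
  shows "r12_r13 scale D r M = contract2 (\<lambda>u v p q. M (D u p) v q)"
    and "r12_r23 scale D r M = contract2 (\<lambda>u v p q. M u (D v p) q)"
    and "r13_r23 scale D r M = contract2 (\<lambda>u v p q. M u p (D v q))"
proof -
  have apply2: "r (\<lambda>u v. r (F u v)) = contract2 F"
    if "\<And>u v. bilinear_form scale (F u v)"
      and "bilinear_form scale (\<lambda>u v. contract (F u v))" for F
    using that by (simp add: r_apply contract2_def)
  note rules = form_iffs bilinear_rules[OF D] trilinear_rules[OF M] contract_linear
  show "r12_r13 scale D r M = contract2 (\<lambda>u v p q. M (D u p) v q)"
    unfolding r12_r13_def lift2_def tensor3_def if_P[OF M] by (rule apply2) (simp_all add: rules)
  show "r12_r23 scale D r M = contract2 (\<lambda>u v p q. M u (D v p) q)"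
    unfolding r12_r23_def lift2_def tensor3_def if_P[OF M] by (rule apply2) (simp_all add: rules)
  show "r13_r23 scale D r M = contract2 (\<lambda>u v p q. M u p (D v q))"
    unfolding r13_r23_def lift2_def tensor3_def if_P[OF M] by (rule apply2) (simp_all add: rules)
qed

lemma AYBE:
  assumes "trilinear_form scale M"
  shows "contract2 (\<lambda>u v p q. M (u \<cdot> p) v q) - contract2 (\<lambda>u v p q. M u (v \<cdot> p) q)
    + contract2 (\<lambda>u v p q. M u p (v \<cdot> q)) = 0"
  using fun_cong[OF associative_YBE, of M] by (simp add: YB_terms[OF mul_bilinear assms])

lemma CYBE:
  assumes "trilinear_form scale M"
  shows "contract2 (\<lambda>u v p q. M (brk u p) v q) + contract2 (\<lambda>u v p q. M u (brk v p) q)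
    + contract2 (\<lambda>u v p q. M u p (brk v q)) = 0"
  using fun_cong[OF classical_YBE, of M] by (simp add: YB_terms[OF brk_bilinear assms])

section \<open>Axioms with one coproduct\<close>

abbreviation Delta where "Delta \<equiv> coboundary_Delta scale mul r"
abbreviation delta where "delta \<equiv> coboundary_delta scale brk r"

lemma mul_linear: "Vector_Spaces.linear scale scale (mul x)"
  using mul_bilinear by (simp add: bilinear_map_def)

lemma brk_linear: "Vector_Spaces.linear scale scale (brk x)"
  using brk_bilinear by (simp add: bilinear_map_def)

lemmas tensors2_intros =
  tensors2_add[OF vector_space_axioms] tensors2_diff[OF vector_space_axioms]
  tensors2_minus[OF vector_space_axioms] tensors2_zero[OF vector_space_axioms]
  tau_in_tensors2[OF vector_space_axioms] tmap2_in_tensors2[OF vector_space_axioms]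
  r_in_tensors2 linear_id mul_linear brk_linear P_linear Q_linear

lemma Delta_in_tensors2: "Delta x \<in> tensors2 scale"
  unfolding coboundary_Delta_def by (intro tensors2_intros)

lemma delta_in_tensors2: "delta x \<in> tensors2 scale"
  unfolding coboundary_delta_def by (intro tensors2_intros)

lemma Delta_apply:
  assumes "bilinear_form scale B"
  shows "Delta x B = contract (\<lambda>u v. B u (x \<cdot> v)) - contract (\<lambda>u v. B (x \<cdot> u) v)"
  using assms
  by (simp add: coboundary_Delta_def tmap2_apply[OF vector_space_axioms] r_apply form_iffs mul_rules)

lemma delta_apply:
  assumes "bilinear_form scale B"
  shows "delta x B = contract (\<lambda>u v. B (brk x u) v) + contract (\<lambda>u v. B u (brk x v))"
  using assms
  by (simp add: coboundary_delta_def tmap2_apply[OF vector_space_axioms] r_apply form_iffs brk_rules)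

lemmas coproduct_simps = form_iffs mul_rules brk_rules P_rules Q_rules
  Delta_apply delta_apply tmap2_apply[OF vector_space_axioms] tau_apply[OF vector_space_axioms]
  contract_linear

lemmas coproduct_tensors2 = tensors2_intros Delta_in_tensors2 delta_in_tensors2

lemmas coproduct_eqI = tensors2_eqI[OF vector_space_axioms]

lemma Delta_linear: "Vector_Spaces.linear scale fscale Delta"
proof -
  have "Delta (x + y) = Delta x + Delta y" for x y
  proof (rule coproduct_eqI)
    fix B assume B: "bilinear_form scale B"
    show "Delta (x + y) B = (Delta x + Delta y) B"
      by (simp add: B coproduct_simps bilinear_rules[OF B])
  qed (intro coproduct_tensors2)+
  moreover have "Delta (scale c x) = fscale c (Delta x)" for c x
  proof (rule coproduct_eqI)
    fix B assume B: "bilinear_form scale B"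
    show "Delta (scale c x) B = fscale c (Delta x) B"
      by (simp add: B fscale_def coproduct_simps bilinear_rules[OF B] algebra_simps)
  qed (intro coproduct_tensors2 tensors2_fscale[OF vector_space_axioms])+
  ultimately show ?thesis
    by (simp add: vs_linear_iff[OF vector_space_axioms fscale_vector_space])
qed

lemma delta_linear: "Vector_Spaces.linear scale fscale delta"
proof -
  have "delta (x + y) = delta x + delta y" for x y
  proof (rule coproduct_eqI)
    fix B assume B: "bilinear_form scale B"
    show "delta (x + y) B = (delta x + delta y) B"
      by (simp add: B coproduct_simps bilinear_rules[OF B])
  qed (intro coproduct_tensors2)+
  moreover have "delta (scale c x) = fscale c (delta x)" for c x
  proof (rule coproduct_eqI)
    fix B assume B: "bilinear_form scale B"
    show "delta (scale c x) B = fscale c (delta x) B"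
      by (simp add: B fscale_def coproduct_simps bilinear_rules[OF B] algebra_simps)
  qed (intro coproduct_tensors2 tensors2_fscale[OF vector_space_axioms])+
  ultimately show ?thesis
    by (simp add: vs_linear_iff[OF vector_space_axioms fscale_vector_space])
qed

lemma tau_Delta: "tau scale (Delta x) = Delta x"
proof (rule coproduct_eqI)
  fix B assume B: "bilinear_form scale B"
  note B' = bilinear_rules[OF B]
  have "contract (\<lambda>u v. B (x \<cdot> v) u) = - contract (\<lambda>u v. B (x \<cdot> u) v)"
    "contract (\<lambda>u v. B v (x \<cdot> u)) = - contract (\<lambda>u v. B u (x \<cdot> v))"
    by (rule contract_flip, simp add: coproduct_simps B')+
  then show "tau scale (Delta x) B = Delta x B"
    by (simp add: B coproduct_simps B')
qed (intro coproduct_tensors2)+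

lemma tau_delta: "tau scale (delta x) = - delta x"
proof (rule coproduct_eqI)
  fix B assume B: "bilinear_form scale B"
  note B' = bilinear_rules[OF B]
  have "contract (\<lambda>u v. B (brk x v) u) = - contract (\<lambda>u v. B (brk x u) v)"
    "contract (\<lambda>u v. B v (brk x u)) = - contract (\<lambda>u v. B u (brk x v))"
    by (rule contract_flip, simp add: coproduct_simps B')+
  then show "tau scale (delta x) B = (- delta x) B"
    by (simp add: B coproduct_simps B')
qed (intro coproduct_tensors2)+

lemma Delta_Q: "Delta (Q x) = tmap2 scale Q id (Delta x) + tmap2 scale id Q (Delta x)"
proof (rule coproduct_eqI)
  fix B assume B: "bilinear_form scale B"
  note B' = bilinear_rules[OF B]
  have "contract (\<lambda>u v. B (x \<cdot> P u) v) = contract (\<lambda>u v. B (x \<cdot> u) (Q v))"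
    by (rule contract_P) (simp add: coproduct_simps B')
  moreover have "contract (\<lambda>u v. B (Q u) (x \<cdot> v)) = contract (\<lambda>u v. B u (x \<cdot> P v))"
    by (rule contract_Q) (simp add: coproduct_simps B')
  ultimately show "Delta (Q x) B = (tmap2 scale Q id (Delta x) + tmap2 scale id Q (Delta x)) B"
    by (simp add: B coproduct_simps B' Q_mul_left)
qed (intro coproduct_tensors2)+

lemma delta_Q: "delta (Q x) = tmap2 scale Q id (delta x) + tmap2 scale id Q (delta x)"
proof (rule coproduct_eqI)
  fix B assume B: "bilinear_form scale B"
  note B' = bilinear_rules[OF B]
  have "contract (\<lambda>u v. B (brk x (P u)) v) = contract (\<lambda>u v. B (brk x u) (Q v))"
    by (rule contract_P) (simp add: coproduct_simps B')
  moreover have "contract (\<lambda>u v. B (Q u) (brk x v)) = contract (\<lambda>u v. B u (brk x (P v)))"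
    by (rule contract_Q) (simp add: coproduct_simps B')
  ultimately show "delta (Q x) B = (tmap2 scale Q id (delta x) + tmap2 scale id Q (delta x)) B"
    by (simp add: B coproduct_simps B' Q_brk_left)
qed (intro coproduct_tensors2)+

lemma Delta_P: "Delta (P x) = tmap2 scale P id (Delta x) - tmap2 scale id Q (Delta x)"
proof (rule coproduct_eqI)
  fix B assume B: "bilinear_form scale B"
  note B' = bilinear_rules[OF B]
  have "contract (\<lambda>u v. B (x \<cdot> P u) v) = contract (\<lambda>u v. B (x \<cdot> u) (Q v))"
    "contract (\<lambda>u v. B (P u) (x \<cdot> v)) = contract (\<lambda>u v. B u (x \<cdot> Q v))"
    by (rule contract_P, simp add: coproduct_simps B')+
  then show "Delta (P x) B = (tmap2 scale P id (Delta x) - tmap2 scale id Q (Delta x)) B"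
    by (simp add: B coproduct_simps B' P_mul Q_mul)
qed (intro coproduct_tensors2)+

lemma delta_P: "delta (P x) = tmap2 scale P id (delta x) - tmap2 scale id Q (delta x)"
proof (rule coproduct_eqI)
  fix B assume B: "bilinear_form scale B"
  note B' = bilinear_rules[OF B]
  have "contract (\<lambda>u v. B (brk x (P u)) v) = contract (\<lambda>u v. B (brk x u) (Q v))"
    "contract (\<lambda>u v. B (P u) (brk x v)) = contract (\<lambda>u v. B u (brk x (Q v)))"
    by (rule contract_P, simp add: coproduct_simps B')+
  then show "delta (P x) B = (tmap2 scale P id (delta x) - tmap2 scale id Q (delta x)) B"
    by (simp add: B coproduct_simps B' P_brk Q_brk)
qed (intro coproduct_tensors2)+

lemma Delta_mul:
  "Delta (x \<cdot> y) = tmap2 scale (mul x) id (Delta y) + tmap2 scale id (mul y) (Delta x)"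
proof (rule coproduct_eqI)
  fix B assume B: "bilinear_form scale B"
  show "Delta (x \<cdot> y) B = (tmap2 scale (mul x) id (Delta y) + tmap2 scale id (mul y) (Delta x)) B"
    by (simp add: B coproduct_simps bilinear_rules[OF B] mul_ac)
qed (intro coproduct_tensors2)+

lemma delta_brk:
  "delta (brk x y) = (tmap2 scale (brk x) id (delta y) + tmap2 scale id (brk x) (delta y))
    - (tmap2 scale (brk y) id (delta x) + tmap2 scale id (brk y) (delta x))"
proof (rule coproduct_eqI)
  fix B assume B: "bilinear_form scale B"
  show "delta (brk x y) B =
    (tmap2 scale (brk x) id (delta y) + tmap2 scale id (brk x) (delta y)
    - (tmap2 scale (brk y) id (delta x) + tmap2 scale id (brk y) (delta x))) B"
    by (simp add: B coproduct_simps bilinear_rules[OF B] brk_brk_left)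
qed (intro coproduct_tensors2)+

text \<open>
  The second leg vanishes by \<open>Q_mul_brk\<close>. In the first leg the relative Leibniz rule leaves the
  term \<open>x \<cdot> y \<cdot> P u\<close>, which the \<open>P\<close>-\<open>Q\<close> rule turns into a part of \<open>(id \<otimes> Q)\<Delta>(x \<cdot> y)\<close>.
\<close>

lemma delta_mul:
  "delta (x \<cdot> y) - tmap2 scale id (brk y) (Delta x) - tmap2 scale (mul x) id (delta y)
    - tmap2 scale id (brk x) (Delta y) - tmap2 scale (mul y) id (delta x)
    - tmap2 scale id Q (Delta (x \<cdot> y)) = 0"
proof (rule coproduct_eqI)
  fix B assume B: "bilinear_form scale B"
  note B' = bilinear_rules[OF B]
  have "contract (\<lambda>u v. B (x \<cdot> y \<cdot> P u) v) = contract (\<lambda>u v. B (x \<cdot> y \<cdot> u) (Q v))"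
    by (rule contract_P) (simp add: coproduct_simps B')
  then show "(delta (x \<cdot> y) - tmap2 scale id (brk y) (Delta x) - tmap2 scale (mul x) id (delta y)
    - tmap2 scale id (brk x) (Delta y) - tmap2 scale (mul y) id (delta x)
    - tmap2 scale id Q (Delta (x \<cdot> y))) B = 0 B"
    by (simp add: B coproduct_simps B' brk_mul_left Q_mul_brk)
qed (intro coproduct_tensors2)+

lemma Delta_brk:
  "Delta (brk x y) - tmap2 scale (mul y) id (delta x) - tmap2 scale id (brk x) (Delta y)
    + tmap2 scale id (mul y) (delta x) - tmap2 scale (brk x) id (Delta y) + Delta (P x \<cdot> y) = 0"
proof (rule coproduct_eqI)
  fix B assume B: "bilinear_form scale B"
  note B' = bilinear_rules[OF B]
  show "(Delta (brk x y) - tmap2 scale (mul y) id (delta x) - tmap2 scale id (brk x) (Delta y)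
    + tmap2 scale id (mul y) (delta x) - tmap2 scale (brk x) id (Delta y) + Delta (P x \<cdot> y)) B = 0 B"
    by (simp add: B coproduct_simps B' relative_leibniz mul_ac)
qed (intro coproduct_tensors2)+

section \<open>Axioms with two coproducts\<close>

text \<open>
  In the iterated coproducts, \<open>u\<close> and \<open>v\<close> are the legs of the copy of \<open>r\<close> in the coproduct
  applied first, and \<open>p\<close> and \<open>q\<close> those of the copy in the second one.
\<close>

lemma id_tensor_Delta_Delta:
  assumes M: "trilinear_form scale M"
  shows "id_tensor scale Delta (Delta x) M =
    contract2 (\<lambda>u v p q. M u p (x \<cdot> (v \<cdot> q))) - contract2 (\<lambda>u v p q. M u (x \<cdot> (v \<cdot> p)) q)
    - contract2 (\<lambda>u v p q. M (x \<cdot> u) p (v \<cdot> q)) + contract2 (\<lambda>u v p q. M (x \<cdot> u) (v \<cdot> p) q)"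
  by (simp add: M id_tensor_apply[OF vector_space_axioms] coproduct_simps trilinear_rules[OF M]
    algebra_simps contract2_def mul_assoc)

lemma tensor_id_Delta_Delta:
  assumes M: "trilinear_form scale M"
  shows "tensor_id scale Delta (Delta x) M =
    contract2 (\<lambda>u v p q. M p (u \<cdot> q) (x \<cdot> v)) - contract2 (\<lambda>u v p q. M (u \<cdot> p) q (x \<cdot> v))
    - contract2 (\<lambda>u v p q. M p (x \<cdot> (u \<cdot> q)) v) + contract2 (\<lambda>u v p q. M (x \<cdot> (u \<cdot> p)) q v)"
  by (simp add: M tensor_id_apply[OF vector_space_axioms] coproduct_simps trilinear_rules[OF M]
    algebra_simps contract2_def mul_assoc)

lemma id_tensor_delta_delta:
  assumes M: "trilinear_form scale M"
  shows "id_tensor scale delta (delta x) M =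
    contract2 (\<lambda>u v p q. M (brk x u) (brk v p) q) + contract2 (\<lambda>u v p q. M (brk x u) p (brk v q))
    + contract2 (\<lambda>u v p q. M u (brk (brk x v) p) q) + contract2 (\<lambda>u v p q. M u p (brk (brk x v) q))"
  by (simp add: M id_tensor_apply[OF vector_space_axioms] coproduct_simps trilinear_rules[OF M]
    algebra_simps contract2_def)

lemma id_tensor_Delta_delta:
  assumes M: "trilinear_form scale M"
  shows "id_tensor scale Delta (delta x) M =
    contract2 (\<lambda>u v p q. M (brk x u) p (v \<cdot> q)) - contract2 (\<lambda>u v p q. M (brk x u) (v \<cdot> p) q)
    + contract2 (\<lambda>u v p q. M u p (brk x v \<cdot> q)) - contract2 (\<lambda>u v p q. M u (brk x v \<cdot> p) q)"
  by (simp add: M id_tensor_apply[OF vector_space_axioms] coproduct_simps trilinear_rules[OF M]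
    algebra_simps contract2_def)

lemma tensor_id_delta_Delta:
  assumes M: "trilinear_form scale M"
  shows "tensor_id scale delta (Delta x) M =
    contract2 (\<lambda>u v p q. M (brk u p) q (x \<cdot> v)) + contract2 (\<lambda>u v p q. M p (brk u q) (x \<cdot> v))
    - contract2 (\<lambda>u v p q. M (brk (x \<cdot> u) p) q v) - contract2 (\<lambda>u v p q. M p (brk (x \<cdot> u) q) v)"
  by (simp add: M tensor_id_apply[OF vector_space_axioms] coproduct_simps trilinear_rules[OF M]
    algebra_simps contract2_def)

lemma id_tensor_delta_Delta:
  assumes M: "trilinear_form scale M"
  shows "id_tensor scale delta (Delta x) M =
    contract2 (\<lambda>u v p q. M u (brk (x \<cdot> v) p) q) + contract2 (\<lambda>u v p q. M u p (brk (x \<cdot> v) q))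
    - contract2 (\<lambda>u v p q. M (x \<cdot> u) (brk v p) q) - contract2 (\<lambda>u v p q. M (x \<cdot> u) p (brk v q))"
  by (simp add: M id_tensor_apply[OF vector_space_axioms] coproduct_simps trilinear_rules[OF M]
    algebra_simps contract2_def)

lemmas coproduct_not_trilinear =
  tensor_not_trilinear[OF vector_space_axioms _ Delta_in_tensors2 Delta_in_tensors2]
  tensor_not_trilinear[OF vector_space_axioms _ Delta_in_tensors2 delta_in_tensors2]
  tensor_not_trilinear[OF vector_space_axioms _ delta_in_tensors2 Delta_in_tensors2]
  tensor_not_trilinear[OF vector_space_axioms _ delta_in_tensors2 delta_in_tensors2]

text \<open>
  Up to exchanging the two copies of \<open>r\<close>, the terms with \<open>x\<close> in the middle slot are the same on
  both sides; the Yang-Baxter equation removes the others.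
\<close>

lemma coassociative: "id_tensor scale Delta (Delta x) = tensor_id scale Delta (Delta x)"
proof
  fix M
  show "id_tensor scale Delta (Delta x) M = tensor_id scale Delta (Delta x) M"
  proof (cases "trilinear_form scale M")
    case M: True
    note M' = trilinear_rules[OF M]
    have 1: "contract2 (\<lambda>u v p q. M (u \<cdot> p) v (x \<cdot> q)) - contract2 (\<lambda>u v p q. M u (v \<cdot> p) (x \<cdot> q))
      + contract2 (\<lambda>u v p q. M u p (x \<cdot> (v \<cdot> q))) = 0"
      by (rule AYBE) (simp add: coproduct_simps M')
    have 2: "contract2 (\<lambda>u v p q. M (x \<cdot> (u \<cdot> p)) v q) - contract2 (\<lambda>u v p q. M (x \<cdot> u) (v \<cdot> p) q)
      + contract2 (\<lambda>u v p q. M (x \<cdot> u) p (v \<cdot> q)) = 0"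
      by (rule AYBE) (simp add: coproduct_simps M')
    have 3: "contract2 (\<lambda>u v p q. M p (u \<cdot> q) (x \<cdot> v)) = contract2 (\<lambda>u v p q. M u (v \<cdot> p) (x \<cdot> q))"
      "contract2 (\<lambda>u v p q. M (u \<cdot> p) q (x \<cdot> v)) = contract2 (\<lambda>u v p q. M (u \<cdot> p) v (x \<cdot> q))"
      "contract2 (\<lambda>u v p q. M p (x \<cdot> (u \<cdot> q)) v) = contract2 (\<lambda>u v p q. M u (x \<cdot> (v \<cdot> p)) q)"
      "contract2 (\<lambda>u v p q. M (x \<cdot> (u \<cdot> p)) q v) = contract2 (\<lambda>u v p q. M (x \<cdot> (u \<cdot> p)) v q)"
      by (subst contract2_swap, simp add: mul_commute)+
    show ?thesis
      unfolding id_tensor_Delta_Delta[OF M] tensor_id_Delta_Delta[OF M] 3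
      using 1 2 by algebra
  qed (simp add: coproduct_not_trilinear)
qed

text \<open>
  For \<open>y = P x + Q x\<close>, the associative Yang-Baxter equation with \<open>y\<close> in the last slot makes
  every term contain a product \<open>y \<cdot> (u \<cdot> v)\<close>, which is zero.
\<close>

lemma Delta_Delta_P_plus_Q: "tensor_id scale Delta (Delta (P x + Q x)) = 0"
proof
  fix M
  show "tensor_id scale Delta (Delta (P x + Q x)) M = 0 M"
  proof (cases "trilinear_form scale M")
    case M: True
    note M' = trilinear_rules[OF M]
    define y where "y = P x + Q x"
    have y: "y \<cdot> (u \<cdot> v) = 0" for u v
      using P_plus_Q_mul_mul[of x u v] by (simp add: y_def mul_assoc)
    have 1: "contract2 (\<lambda>u v p q. M (u \<cdot> p) v (y \<cdot> q)) - contract2 (\<lambda>u v p q. M u (v \<cdot> p) (y \<cdot> q))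
      + contract2 (\<lambda>u v p q. M u p (y \<cdot> (v \<cdot> q))) = 0"
      by (rule AYBE) (simp add: coproduct_simps M')
    have 2: "contract2 (\<lambda>u v p q. M p (u \<cdot> q) (y \<cdot> v)) = contract2 (\<lambda>u v p q. M u (v \<cdot> p) (y \<cdot> q))"
      "contract2 (\<lambda>u v p q. M (u \<cdot> p) q (y \<cdot> v)) = contract2 (\<lambda>u v p q. M (u \<cdot> p) v (y \<cdot> q))"
      by (subst contract2_swap, simp add: mul_commute)+
    show ?thesis
      using 1 unfolding y_def[symmetric] tensor_id_Delta_Delta[OF M] 2
      by (simp add: y M' contract2_linear)
  qed (simp add: coproduct_not_trilinear)
qed

lemma id_tensor_delta_delta_CYBE:
  assumes M: "trilinear_form scale M"
  shows "id_tensor scale delta (delta x) M =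
    contract2 (\<lambda>u v p q. M u (brk (brk x v) p) q) + contract2 (\<lambda>u v p q. M u p (brk (brk x v) q))
    - contract2 (\<lambda>u v p q. M (brk x (brk u p)) v q)"
proof -
  have "contract2 (\<lambda>u v p q. M (brk x (brk u p)) v q) + contract2 (\<lambda>u v p q. M (brk x u) (brk v p) q)
      + contract2 (\<lambda>u v p q. M (brk x u) p (brk v q)) = 0"
    by (rule CYBE) (simp add: coproduct_simps trilinear_rules[OF M])
  then show ?thesis
    unfolding id_tensor_delta_delta[OF M] by algebra
qed

text \<open>
  A cyclic rotation moves each double bracket of \<open>id_tensor_delta_delta_CYBE\<close> into the first slot.
  Antisymmetry and the exchange of the two copies of \<open>r\<close> then give the legs the same order in
  all three terms, and the double brackets add up to zero by the Jacobi identity.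
\<close>

lemma cojacobi:
  "id_tensor scale delta (delta x) + xi scale (id_tensor scale delta (delta x))
    + xi scale (xi scale (id_tensor scale delta (delta x))) = 0"
proof
  let ?J = "id_tensor scale delta (delta x)"
  have xi: "xi scale t M = t (\<lambda>u v w. M v w u)" if "trilinear_form scale M" for t M
    using that by (simp add: xi_def lift3_def tensor3_def)
  have J: "?J M + ?J (\<lambda>u v w. M v w u) + ?J (\<lambda>u v w. M w u v) = 0"
    if M: "trilinear_form scale M" for M
  proof -
    note M' = trilinear_rules[OF M]
    have N: "trilinear_form scale (\<lambda>u v w. M v w u)" "trilinear_form scale (\<lambda>u v w. M w u v)"
      by (simp_all add: coproduct_simps M')
    have rotate_second: "contract2 (\<lambda>u v p q. M (brk (brk x v) p) q u) = - contract2 (\<lambda>u v p q. M (brk (brk x p) u) v q)"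
      if M: "trilinear_form scale M" for M
    proof -
      have "contract2 (\<lambda>u v p q. M (brk (brk x v) p) q u) = - contract2 (\<lambda>u v p q. M (brk (brk x u) p) q v)"
        by (rule contract2_flip1) (simp add: coproduct_simps trilinear_rules[OF M])
      also have "contract2 (\<lambda>u v p q. M (brk (brk x u) p) q v) = contract2 (\<lambda>u v p q. M (brk (brk x p) u) v q)"
        by (rule contract2_swap)
      finally show ?thesis .
    qed
    have rotate_third: "contract2 (\<lambda>u v p q. M (brk (brk x v) q) u p) = contract2 (\<lambda>u v p q. M (brk (brk x u) p) v q)"
      if M: "trilinear_form scale M" for M
    proof -
      have "contract2 (\<lambda>u v p q. M (brk (brk x v) q) u p) = - contract2 (\<lambda>u v p q. M (brk (brk x u) q) v p)"
        by (rule contract2_flip1) (simp add: coproduct_simps trilinear_rules[OF M])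
      also have "contract2 (\<lambda>u v p q. M (brk (brk x u) q) v p) = - contract2 (\<lambda>u v p q. M (brk (brk x u) p) v q)"
        by (rule contract2_flip2) (simp add: coproduct_simps trilinear_rules[OF M])
      finally show ?thesis by simp
    qed
    have jac: "brk (brk x u) p = brk (brk x p) u + brk x (brk u p)" for u p
      using brk_brk_left[of x u p] brk_anti[of "brk x p" u] by simp
    have collect: "contract2 (\<lambda>u v p q. M (brk (brk x u) p) v q) =
      contract2 (\<lambda>u v p q. M (brk (brk x p) u) v q) + contract2 (\<lambda>u v p q. M (brk x (brk u p)) v q)"
      if M: "trilinear_form scale M" for M
    proof -
      have "contract2 (\<lambda>u v p q. M (brk (brk x u) p) v q) =
        contract2 (\<lambda>u v p q. M (brk (brk x p) u + brk x (brk u p)) v q)"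
        by (subst jac) (rule refl)
      then show ?thesis by (simp only: trilinear_rules[OF M] contract2_linear)
    qed
    show ?thesis
      unfolding id_tensor_delta_delta_CYBE[OF M] id_tensor_delta_delta_CYBE[OF N(1)]
        id_tensor_delta_delta_CYBE[OF N(2)]
        rotate_second[OF M] rotate_second[OF N(1)] rotate_second[OF N(2)]
        rotate_third[OF M] rotate_third[OF N(1)] rotate_third[OF N(2)]
      using collect[OF M] collect[OF N(1)] collect[OF N(2)] by algebra
  qed
  fix M
  show "(?J + xi scale ?J + xi scale (xi scale ?J)) M = 0 M"
  proof (cases "trilinear_form scale M")
    case M: True
    then have "trilinear_form scale (\<lambda>u v w. M v w u)"
      by (simp add: coproduct_simps trilinear_rules[OF M])
    with J[OF M] M show ?thesis by (simp add: xi)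
  next
    case False
    have "?J (\<lambda>u v w. 0) = 0"
      by (simp add: id_tensor_delta_delta zero_trilinear[OF vector_space_axioms] contract2_linear)
    with False show ?thesis
      by (simp add: coproduct_not_trilinear) (simp add: xi_def lift3_def tensor3_def zero_trilinear[OF vector_space_axioms])
  qed
qed

text \<open>
  After the exchange of the two copies of \<open>r\<close> and antisymmetry have given the legs the order in
  which they occur in the Yang-Baxter equations, the terms with \<open>x\<close> in the first slot cancel by
  the associative equation and \<open>Q_mul_brk\<close>. Those with \<open>x\<close> in the second or third slot reduce by
  the classical equation and the relative Leibniz rule to terms with a factor \<open>P v\<close>; moving this
  \<open>P\<close> to the other leg gives terms with \<open>Q\<close> in the first slot, which cancel against the iterated
  \<open>\<Delta>\<close>, in the third slot by one more use of the associative equation.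
\<close>

lemma corelative_leibniz:
  "id_tensor scale Delta (delta x) - tensor_id scale delta (Delta x)
    - tau_id scale (id_tensor scale delta (Delta x))
    - tmap3 scale Q id id (tensor_id scale Delta (Delta x)) = 0"
proof
  fix M
  show "(id_tensor scale Delta (delta x) - tensor_id scale delta (Delta x)
    - tau_id scale (id_tensor scale delta (Delta x))
    - tmap3 scale Q id id (tensor_id scale Delta (Delta x))) M = 0 M"
  proof (cases "trilinear_form scale M")
    case M: True
    note M' = trilinear_rules[OF M]
    have N: "trilinear_form scale (\<lambda>u v w. M v u w)" "trilinear_form scale (\<lambda>u v w. M (Q u) v w)"
      by (simp_all add: coproduct_simps M')
    have tau: "tau_id scale t M = t (\<lambda>u v w. M v u w)" for t
      using M by (simp add: tau_id_def lift3_def tensor3_def)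
    have tQ: "tmap3 scale Q id id t M = t (\<lambda>u v w. M (Q u) v w)" for t
      using M by (simp add: tmap3_def lift3_def tensor3_def)
    \<comment> \<open>terms with \<open>x\<close> in the first slot\<close>
    have A1: "contract2 (\<lambda>u v p q. M (brk x (u \<cdot> p)) v q) - contract2 (\<lambda>u v p q. M (brk x u) (v \<cdot> p) q)
      + contract2 (\<lambda>u v p q. M (brk x u) p (v \<cdot> q)) = 0"
      by (rule AYBE) (simp add: coproduct_simps M')
    have s1: "contract2 (\<lambda>u v p q. M (brk (x \<cdot> u) p) q v) = contract2 (\<lambda>u v p q. M (brk (x \<cdot> p) u) v q)"
      by (rule contract2_swap)
    have s2: "contract2 (\<lambda>u v p q. M (brk (x \<cdot> v) p) u q) = - contract2 (\<lambda>u v p q. M (brk (x \<cdot> u) p) v q)"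
      by (rule contract2_flip1) (simp add: coproduct_simps M')
    have s3: "contract2 (\<lambda>u v p q. M (Q (x \<cdot> (u \<cdot> p))) q v) = contract2 (\<lambda>u v p q. M (Q (x \<cdot> (u \<cdot> p))) v q)"
      by (subst contract2_swap) (simp add: mul_commute)
    have "Q (x \<cdot> (u \<cdot> p)) = brk (x \<cdot> p) u + brk (x \<cdot> u) p - brk x (u \<cdot> p)" for u p
      using Q_mul_brk[of x u p] brk_anti[of "x \<cdot> p" u] by (simp add: mul_assoc)
    then have S1: "contract2 (\<lambda>u v p q. M (Q (x \<cdot> (u \<cdot> p))) v q) =
       contract2 (\<lambda>u v p q. M (brk (x \<cdot> p) u) v q) + contract2 (\<lambda>u v p q. M (brk (x \<cdot> u) p) v q)
       - contract2 (\<lambda>u v p q. M (brk x (u \<cdot> p)) v q)"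
      by (simp add: M' contract2_linear)
    \<comment> \<open>terms with \<open>x\<close> in the third slot; \<open>A3\<close> absorbs the error term of \<open>L\<close>, rewritten by \<open>t6\<close>\<close>
    have C3: "contract2 (\<lambda>u v p q. M (brk u p) v (x \<cdot> q)) + contract2 (\<lambda>u v p q. M u (brk v p) (x \<cdot> q))
      + contract2 (\<lambda>u v p q. M u p (x \<cdot> brk v q)) = 0"
      by (rule CYBE) (simp add: coproduct_simps M')
    have A3: "contract2 (\<lambda>u v p q. M (Q (u \<cdot> p)) v (x \<cdot> q)) - contract2 (\<lambda>u v p q. M (Q u) (v \<cdot> p) (x \<cdot> q))
      + contract2 (\<lambda>u v p q. M (Q u) p (x \<cdot> (v \<cdot> q))) = 0"
      by (rule AYBE) (simp add: coproduct_simps M')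
    have t1: "contract2 (\<lambda>u v p q. M (brk u p) q (x \<cdot> v)) = - contract2 (\<lambda>u v p q. M (brk u p) v (x \<cdot> q))"
      by (subst contract2_swap, subst brk_anti) (simp add: M' contract2_linear)
    have t2: "contract2 (\<lambda>u v p q. M p (brk u q) (x \<cdot> v)) = - contract2 (\<lambda>u v p q. M u (brk v p) (x \<cdot> q))"
      by (subst contract2_swap, subst brk_anti) (simp add: M' contract2_linear)
    have t3: "contract2 (\<lambda>u v p q. M p u (brk (x \<cdot> v) q)) = contract2 (\<lambda>u v p q. M u p (brk (x \<cdot> q) v))"
      by (rule contract2_swap)
    have t4: "contract2 (\<lambda>u v p q. M (Q p) (u \<cdot> q) (x \<cdot> v)) = contract2 (\<lambda>u v p q. M (Q u) (v \<cdot> p) (x \<cdot> q))"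
      by (subst contract2_swap) (simp add: mul_commute)
    have t5: "contract2 (\<lambda>u v p q. M (Q (u \<cdot> p)) q (x \<cdot> v)) = contract2 (\<lambda>u v p q. M (Q (u \<cdot> p)) v (x \<cdot> q))"
      by (subst contract2_swap) (simp add: mul_commute)
    have t6: "contract2 (\<lambda>u v p q. M (Q u) p (x \<cdot> (v \<cdot> q))) = contract2 (\<lambda>u v p q. M u p (x \<cdot> (P v \<cdot> q)))"
      by (rule contract2_Q1) (simp add: coproduct_simps M')
    have L: "brk (x \<cdot> q) v = brk x v \<cdot> q - x \<cdot> brk v q - x \<cdot> (P v \<cdot> q)" for q v
      using brk_anti[of q v] by (simp add: brk_mul_left mul_rules mul_ac)
    have S3: "contract2 (\<lambda>u v p q. M u p (brk (x \<cdot> q) v)) =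
       contract2 (\<lambda>u v p q. M u p (brk x v \<cdot> q)) - contract2 (\<lambda>u v p q. M u p (x \<cdot> brk v q))
       - contract2 (\<lambda>u v p q. M u p (x \<cdot> (P v \<cdot> q)))"
      by (simp add: L M' contract2_linear)
    \<comment> \<open>terms with \<open>x\<close> in the second slot; here the error term of \<open>L\<close> cancels by \<open>w5\<close> alone\<close>
    have C2: "contract2 (\<lambda>u v p q. M (brk u p) (x \<cdot> v) q) + contract2 (\<lambda>u v p q. M u (x \<cdot> brk v p) q)
      + contract2 (\<lambda>u v p q. M u (x \<cdot> p) (brk v q)) = 0"
      by (rule CYBE) (simp add: coproduct_simps M')
    have w1: "contract2 (\<lambda>u v p q. M p (brk (x \<cdot> u) q) v) = contract2 (\<lambda>u v p q. M u (brk (x \<cdot> p) v) q)"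
      by (rule contract2_swap)
    have w2: "contract2 (\<lambda>u v p q. M (brk v p) (x \<cdot> u) q) = - contract2 (\<lambda>u v p q. M (brk u p) (x \<cdot> v) q)"
      by (rule contract2_flip1) (simp add: coproduct_simps M')
    have w3: "contract2 (\<lambda>u v p q. M p (x \<cdot> u) (brk v q)) = - contract2 (\<lambda>u v p q. M u (x \<cdot> p) (brk v q))"
      by (subst contract2_swap, subst brk_anti) (simp add: M' contract2_linear)
    have w4: "contract2 (\<lambda>u v p q. M (Q p) (x \<cdot> (u \<cdot> q)) v) = contract2 (\<lambda>u v p q. M (Q u) (x \<cdot> (v \<cdot> p)) q)"
      by (subst contract2_swap) (simp add: mul_commute)
    have w5: "contract2 (\<lambda>u v p q. M (Q u) (x \<cdot> (v \<cdot> p)) q) = contract2 (\<lambda>u v p q. M u (x \<cdot> (P v \<cdot> p)) q)"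
      by (rule contract2_Q1) (simp add: coproduct_simps M')
    have S2: "contract2 (\<lambda>u v p q. M u (brk (x \<cdot> p) v) q) =
       contract2 (\<lambda>u v p q. M u (brk x v \<cdot> p) q) - contract2 (\<lambda>u v p q. M u (x \<cdot> brk v p) q)
       - contract2 (\<lambda>u v p q. M u (x \<cdot> (P v \<cdot> p)) q)"
      by (simp add: L M' contract2_linear)
    have "id_tensor scale Delta (delta x) M - tensor_id scale delta (Delta x) M
      - id_tensor scale delta (Delta x) (\<lambda>u v w. M v u w)
      - tensor_id scale Delta (Delta x) (\<lambda>u v w. M (Q u) v w) = 0"
      unfolding id_tensor_Delta_delta[OF M] tensor_id_delta_Delta[OF M]
        id_tensor_delta_Delta[OF N(1)] tensor_id_Delta_Delta[OF N(2)]
        s1 s2 s3 S1 t1 t2 t3 t4 t5 S3 w1 w2 w3 w4 S2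
      using A1 C3 A3 t6 C2 w5 by algebra
    then show ?thesis by (simp add: tau tQ)
  next
    case False
    have "id_tensor scale delta (Delta x) (\<lambda>u v w. 0) = 0"
      "tensor_id scale Delta (Delta x) (\<lambda>u v w. 0) = 0"
      by (simp_all add: id_tensor_delta_Delta tensor_id_Delta_Delta zero_trilinear[OF vector_space_axioms] contract2_linear)
    with False show ?thesis
      by (simp add: coproduct_not_trilinear) (simp add: tau_id_def tmap3_def lift3_def tensor3_def)
  qed
qed

section \<open>The coboundary bialgebra\<close>

theorem coboundary_bialgebra: "relative_poisson_bialgebra scale mul brk Delta delta P Q"
  by (intro relative_poisson_bialgebra.intro relative_poisson_algebra_axioms
      relative_poisson_coalgebra.intro vector_space_axioms
      relative_poisson_coalgebra_axioms.intro relative_poisson_bialgebra_axioms.intro)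
    (fact Delta_linear Delta_in_tensors2 delta_linear delta_in_tensors2 Q_linear tau_Delta
      coassociative tau_delta cojacobi Delta_Q delta_Q corelative_leibniz Q_dual Delta_P delta_P
      Delta_Delta_P_plus_Q Delta_mul delta_brk delta_mul Delta_brk)+

end

theorem corollary4p5:
  fixes scale :: "'k::{alg_closed_field, field_char_0} \<Rightarrow> 'a::ab_group_add \<Rightarrow> 'a"
    and Basis :: "'a set"
    and mul brk :: "'a \<Rightarrow> 'a \<Rightarrow> 'a"
    and P Q :: "'a \<Rightarrow> 'a"
    and r :: "('a, 'k) tens2"
    and \<Delta> \<delta> :: "'a \<Rightarrow> ('a, 'k) tens2"
  assumes "finite_dimensional_vector_space scale Basis"
    and "relative_poisson_algebra scale mul brk P"
    and "dually_represents scale mul brk P Q"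
    and "r \<in> tensors2 scale"
    and "\<And>x. \<Delta> x = tmap2 scale id (mul x) r - tmap2 scale (mul x) id r"
    and "\<And>x. \<delta> x = tmap2 scale (brk x) id r + tmap2 scale id (brk x) r"
    and "r + tau scale r = 0"
    and "r12_r13 scale mul r - r12_r23 scale mul r + r13_r23 scale mul r = 0"
    and "r12_r13 scale brk r + r12_r23 scale brk r + r13_r23 scale brk r = 0"
    and "tmap2 scale P id r - tmap2 scale id Q r = 0"
    and "tmap2 scale Q id r - tmap2 scale id P r = 0"
  shows "coboundary_relative_poisson_bialgebra scale mul brk \<Delta> \<delta> P Q"
proof -
  interpret A: relative_poisson_algebra scale mul brk P by (rule assms(2))
  obtain n :: nat and a b where r: "r = (\<Sum>i<n. tensor2 scale (a i) (b i))"
    using tensors2_as_sum[OF A.vector_space_axioms assms(4)] by blast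
  interpret yang_baxter_solution scale mul brk P Q r n a b
    by unfold_locales (fact assms r)+
  have "\<Delta> = coboundary_Delta scale mul r" "\<delta> = coboundary_delta scale brk r"
    using assms(5,6) by (auto simp: coboundary_Delta_def coboundary_delta_def)
  then show ?thesis
    using coboundary_bialgebra assms(4) by (auto simp: coboundary_relative_poisson_bialgebra_def)
qed

end
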